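(* Let $\lambda\vdash n$ be a partition whose Young diagram has $m$ columns, and let $l_c$ denote the length of column $c$. Let $\tilde S^\lambda:=M^\lambda/\langle\tilde g^t_c: t\in\mathcal T_\lambda,\ 2\le c\le m\rangle$, where $\tilde g_c^t:=(c-1)\,l_c\,\bar t-\sum_s\bar s$, the sum being over all tableaux $s$ obtained from $t$ by switching any entry of column $c$ with any entry of any column $c'<c$. Then $\tilde S^\lambda\cong S^\lambda$ as $\mathfrak S_n$-modules.
   Context: A Young tableau of shape $\lambda\vdash n$ is a filling of the Young diagram of $\lambda$ with the distinct entries $1,\dots,n$; $\mathcal T_\lambda$ is the set of these. $M^\lambda$ is the complex vector space generated by $\mathcal T_\lambda$ subject only to the column relations $t+s$, where $s$ is obtained from $t$ by switching two entries in the same column; $\bar t$ is the image of $t$ in $M^\lambda$. $\mathfrak S_n$ acts by replacing each entry with its image. $S^\lambda$ is the Specht module (irreducible complex $\mathfrak S_n$-representation) indexed by $\lambda$. *)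

theory Defs
  imports
    "HOL-Algebra.Sym_Groups"
    "HOL-Algebra.Group_Action"
    "HOL-Algebra.AbelCoset"
    "HOL-Algebra.Module"
    "HOL-Algebra.Algebraic_Closure_Type"
    "HOL-Library.Poly_Mapping"
begin

section \<open>Linear representations on HOL-Algebra modules\<close>

abbreviation complex_ring :: "complex ring"
  where "complex_ring \<equiv> ring_of_type_algebra"

locale linear_representation =
  module R V + group_action G "carrier V" \<rho>
  for R :: "('r, 'x) ring_scheme" and V :: "('r, 'v, 'y) module_scheme"
    and G :: "('g, 'z) monoid_scheme" and \<rho> :: "'g \<Rightarrow> 'v \<Rightarrow> 'v" +
  assumes act_add: "\<lbrakk>g \<in> carrier G; v \<in> carrier V; w \<in> carrier V\<rbrakk>
      \<Longrightarrow> \<rho> g (v \<oplus>\<^bsub>V\<^esub> w) = \<rho> g v \<oplus>\<^bsub>V\<^esub> \<rho> g w"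
    and act_smult: "\<lbrakk>g \<in> carrier G; a \<in> carrier R; v \<in> carrier V\<rbrakk>
      \<Longrightarrow> \<rho> g (a \<odot>\<^bsub>V\<^esub> v) = a \<odot>\<^bsub>V\<^esub> \<rho> g v"

definition isomorphic_representations ::
  "('r, 'x) ring_scheme \<Rightarrow> ('g, 'z) monoid_scheme
    \<Rightarrow> ('r, 'v, 'y) module_scheme \<Rightarrow> ('g \<Rightarrow> 'v \<Rightarrow> 'v)
    \<Rightarrow> ('r, 'w, 'y2) module_scheme \<Rightarrow> ('g \<Rightarrow> 'w \<Rightarrow> 'w) \<Rightarrow> bool"
  where "isomorphic_representations R G V \<rho> W \<sigma> \<longleftrightarrow>
    linear_representation R V G \<rho> \<and> linear_representation R W G \<sigma> \<and>
    (\<exists>\<phi> \<in> iso (add_monoid V) (add_monoid W).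
       (\<forall>a \<in> carrier R. \<forall>v \<in> carrier V. \<phi> (a \<odot>\<^bsub>V\<^esub> v) = a \<odot>\<^bsub>W\<^esub> \<phi> v) \<and>
       (\<forall>g \<in> carrier G. \<forall>v \<in> carrier V. \<phi> (\<rho> g v) = \<sigma> g (\<phi> v)))"

definition generated_submodule ::
  "('r, 'x) ring_scheme \<Rightarrow> ('r, 'v, 'y) module_scheme \<Rightarrow> 'v set \<Rightarrow> 'v set"
  where "generated_submodule R V A = (\<lambda>N. submodule N R V) hull A"

text \<open>The multiplicative fields of the module record play no role in \<^locale>\<open>module\<close>,
  so they are left \<^const>\<open>undefined\<close>.  As for \<^const>\<open>rcoset_mult\<close>, scalar multiplication of cosets
  is a union over representatives; for a submodule \<open>N\<close> all the united cosets coincide.\<close>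

definition quotient_module ::
  "('r, 'v, 'y) module_scheme \<Rightarrow> 'v set \<Rightarrow> ('r, 'v set) module"
  where "quotient_module V N =
    \<lparr> carrier = a_rcosets\<^bsub>V\<^esub> N, monoid.mult = undefined, one = undefined,
      ring.zero = N, add = set_add V,
      module.smult = (\<lambda>a A. \<Union>x\<in>A. N +>\<^bsub>V\<^esub> (a \<odot>\<^bsub>V\<^esub> x)) \<rparr>"

text \<open>\<^locale>\<open>group_action\<close> asks for extensional functions, hence the restrictions below.\<close>

definition quotient_act ::
  "('r, 'v, 'y) module_scheme \<Rightarrow> 'v set \<Rightarrow> ('g \<Rightarrow> 'v \<Rightarrow> 'v) \<Rightarrow> 'g \<Rightarrow> 'v set \<Rightarrow> 'v set"
  where "quotient_act V N \<rho> g = (\<lambda>A \<in> carrier (quotient_module V N). \<rho> g ` A)"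

definition free_module :: "'a set \<Rightarrow> (complex, 'a \<Rightarrow>\<^sub>0 complex) module"
  where "free_module A =
    \<lparr> carrier = {f. Poly_Mapping.keys f \<subseteq> A}, monoid.mult = undefined, one = undefined,
      ring.zero = 0, add = (+), module.smult = (\<lambda>a. Poly_Mapping.map ((*) a)) \<rparr>"

definition free_act ::
  "'a set \<Rightarrow> ('g \<Rightarrow> 'a \<Rightarrow> 'a) \<Rightarrow> 'g \<Rightarrow> ('a \<Rightarrow>\<^sub>0 complex) \<Rightarrow> ('a \<Rightarrow>\<^sub>0 complex)"
  where "free_act A \<alpha> g = (\<lambda>f \<in> carrier (free_module A).
    \<Sum>x\<in>Poly_Mapping.keys f. Poly_Mapping.single (\<alpha> g x) (Poly_Mapping.lookup f x))"

section \<open>Young diagrams and tableaux\<close>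

definition is_partition :: "nat list \<Rightarrow> nat \<Rightarrow> bool"
  where "is_partition lam n \<longleftrightarrow> sorted_wrt (\<ge>) lam \<and> (\<forall>p\<in>set lam. 0 < p) \<and> sum_list lam = n"

text \<open>Cells are pairs (row, column), both numbered from 1.\<close>

definition diagram :: "nat list \<Rightarrow> (nat \<times> nat) set"
  where "diagram lam = {(i, j). 1 \<le> i \<and> i \<le> length lam \<and> 1 \<le> j \<and> j \<le> lam ! (i - 1)}"

definition diagram_row :: "nat list \<Rightarrow> nat \<Rightarrow> (nat \<times> nat) set"
  where "diagram_row lam i = {x \<in> diagram lam. fst x = i}"

definition diagram_column :: "nat list \<Rightarrow> nat \<Rightarrow> (nat \<times> nat) set"
  where "diagram_column lam c = {x \<in> diagram lam. snd x = c}"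

definition num_columns :: "nat list \<Rightarrow> nat"
  where "num_columns lam = card (snd ` diagram lam)"

type_synonym tableau = "nat \<times> nat \<Rightarrow> nat"

text \<open>A tableau takes the dummy value 0 outside the diagram, which makes it determined by its
  entries.  Permutations of \<open>{1..n}\<close> fix 0, so \<open>\<sigma> \<circ> t\<close> replaces each entry of \<open>t\<close> by its image.\<close>

definition tableaux :: "nat list \<Rightarrow> tableau set"
  where "tableaux lam =
    {t. bij_betw t (diagram lam) {1..sum_list lam} \<and> (\<forall>x. x \<notin> diagram lam \<longrightarrow> t x = 0)}"

definition tableau_act :: "(nat \<Rightarrow> nat) \<Rightarrow> tableau \<Rightarrow> tableau"
  where "tableau_act \<sigma> t = \<sigma> \<circ> t"

definition switch :: "nat \<times> nat \<Rightarrow> nat \<times> nat \<Rightarrow> tableau \<Rightarrow> tableau"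
  where "switch x y t = t \<circ> Transposition.transpose x y"

section \<open>The module of column tableaux and its quotient\<close>

definition column_relations :: "nat list \<Rightarrow> (tableau \<Rightarrow>\<^sub>0 complex) set"
  where "column_relations lam = generated_submodule complex_ring (free_module (tableaux lam))
    {Poly_Mapping.single t 1 + Poly_Mapping.single (switch x y t) 1 | t x y c.
       t \<in> tableaux lam \<and> x \<in> diagram_column lam c \<and> y \<in> diagram_column lam c \<and> x \<noteq> y}"

definition column_module :: "nat list \<Rightarrow> (complex, (tableau \<Rightarrow>\<^sub>0 complex) set) module"
  where "column_module lam = quotient_module (free_module (tableaux lam)) (column_relations lam)"

definition column_module_act ::
  "nat list \<Rightarrow> (nat \<Rightarrow> nat) \<Rightarrow>
    (tableau \<Rightarrow>\<^sub>0 complex) set \<Rightarrow> (tableau \<Rightarrow>\<^sub>0 complex) set"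
  where "column_module_act lam =
    quotient_act (free_module (tableaux lam)) (column_relations lam)
      (free_act (tableaux lam) tableau_act)"

definition tableau_class ::
  "nat list \<Rightarrow> tableau \<Rightarrow> (tableau \<Rightarrow>\<^sub>0 complex) set"
  where "tableau_class lam t =
    column_relations lam +>\<^bsub>free_module (tableaux lam)\<^esub> Poly_Mapping.single t 1"

definition left_switches ::
  "nat list \<Rightarrow> nat \<Rightarrow> tableau \<Rightarrow> tableau set"
  where "left_switches lam c t =
    {switch x y t | x y c'. c' < c \<and> x \<in> diagram_column lam c \<and> y \<in> diagram_column lam c'}"

definition g_tilde ::
  "nat list \<Rightarrow> nat \<Rightarrow> tableau \<Rightarrow> (tableau \<Rightarrow>\<^sub>0 complex) set"
  where "g_tilde lam c t =
    of_nat ((c - 1) * card (diagram_column lam c)) \<odot>\<^bsub>column_module lam\<^esub> tableau_class lam t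
      \<ominus>\<^bsub>column_module lam\<^esub> (\<Oplus>\<^bsub>column_module lam\<^esub>s\<in>left_switches lam c t. tableau_class lam s)"

definition g_tilde_relations ::
  "nat list \<Rightarrow> (tableau \<Rightarrow>\<^sub>0 complex) set set"
  where "g_tilde_relations lam = generated_submodule complex_ring (column_module lam)
    {g_tilde lam c t | c t. t \<in> tableaux lam \<and> 2 \<le> c \<and> c \<le> num_columns lam}"

definition S_tilde ::
  "nat list \<Rightarrow> (complex, (tableau \<Rightarrow>\<^sub>0 complex) set set) module"
  where "S_tilde lam = quotient_module (column_module lam) (g_tilde_relations lam)"

definition S_tilde_act ::
  "nat list \<Rightarrow> (nat \<Rightarrow> nat) \<Rightarrow>
    (tableau \<Rightarrow>\<^sub>0 complex) set set \<Rightarrow> (tableau \<Rightarrow>\<^sub>0 complex) set set"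
  where "S_tilde_act lam =
    quotient_act (column_module lam) (g_tilde_relations lam) (column_module_act lam)"

section \<open>Specht modules\<close>

text \<open>The Specht module is the span of the polytabloids inside the permutation module on
  tabloids; a tabloid is a class of tableaux with the same set of entries in each row.  With this
  convention a one-row partition gives the trivial and a one-column partition the sign
  representation.\<close>

definition tabloid :: "nat list \<Rightarrow> tableau \<Rightarrow> tableau set"
  where "tabloid lam t = {s \<in> tableaux lam. \<forall>i. s ` diagram_row lam i = t ` diagram_row lam i}"

definition tabloids :: "nat list \<Rightarrow> tableau set set"
  where "tabloids lam = tabloid lam ` tableaux lam"

definition tabloid_act ::
  "(nat \<Rightarrow> nat) \<Rightarrow> tableau set \<Rightarrow> tableau set"
  where "tabloid_act \<sigma> T = tableau_act \<sigma> ` T"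

definition column_stabilizer :: "nat list \<Rightarrow> tableau \<Rightarrow> (nat \<Rightarrow> nat) set"
  where "column_stabilizer lam t =
    {q \<in> carrier (sym_group (sum_list lam)). \<forall>c. q ` t ` diagram_column lam c = t ` diagram_column lam c}"

definition polytabloid ::
  "nat list \<Rightarrow> tableau \<Rightarrow> (tableau set \<Rightarrow>\<^sub>0 complex)"
  where "polytabloid lam t = (\<Sum>q\<in>column_stabilizer lam t.
    Poly_Mapping.single (tabloid lam (tableau_act q t)) (of_int (sign q)))"

definition specht_module ::
  "nat list \<Rightarrow> (complex, tableau set \<Rightarrow>\<^sub>0 complex) module"
  where "specht_module lam = (free_module (tabloids lam))
    \<lparr> carrier := generated_submodule complex_ring (free_module (tabloids lam))
        (polytabloid lam ` tableaux lam) \<rparr>"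

definition specht_act ::
  "nat list \<Rightarrow> (nat \<Rightarrow> nat) \<Rightarrow>
    (tableau set \<Rightarrow>\<^sub>0 complex) \<Rightarrow> (tableau set \<Rightarrow>\<^sub>0 complex)"
  where "specht_act lam \<sigma> =
    restrict (free_act (tabloids lam) tabloid_act \<sigma>) (carrier (specht_module lam))"

end

theory Submission
  imports Defs
begin

text \<open>Sending a tableau to its polytabloid kills the column relations and, by the Garnir relations with a
  single exchanged entry, all \<open>g_tilde\<close>. To see that nothing else is killed, decompose an element of
  the kernel orthogonally into a combination of relations and a function \<open>v\<close> on tableaux that is orthogonal
  to them, so \<open>v\<close> is antisymmetric in the columns. If \<open>H\<close> denotes the sum of the switches of a fixed
  cell with the cells of another column of length \<open>a\<close>, then \<open>(1 - H)\<^sup>2 = (a + 1) (1 - H)\<close> on such functions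
  and \<open>H\<close> is self-adjoint. Orthogonality to \<open>g_tilde\<close> therefore says that a sum of positive multiples of the
  squared norms of the functions \<open>(1 - H) v\<close> vanishes, so each single exchange relation holds for \<open>v\<close>.
  These relations leave only a one-dimensional space of functions that are moreover antisymmetric under the column
  stabilizer of a given tableau \<open>s\<close> acting on entries. That space is spanned by an element \<open>u\<close> which comes from
  coefficients of polytabloids and hence is orthogonal to \<open>v\<close>; this forces \<open>v s = 0\<close>.\<close>

section \<open>Quotients of modules and representations\<close>

text \<open>The obstacle is that each generator averages over all entries of a column and all
  columns to its left, so no single exchange relation can be read off from it. The averaging is
  undone on the orthogonal complement of the relations: there each summand enters through a squared
  norm, and a vanishing sum of nonnegative reals vanishes termwise. This is why the argument
  concerns functions on tableaux with a Hermitian pairing rather than elements of the quotient. The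
  constant \<open>a + 1\<close> is the index of the symmetric group on the \<open>a\<close> cells of
  a column in that on these cells and one more: on functions antisymmetric in the column,
  \<open>1 - H\<close> is the signed sum over coset representatives. Two commuting actions are in
  play. The relations permute cells, whereas the group and the column stabilizer of \<open>s\<close>
  permute entries. The element \<open>u\<close> satisfies the relations for cells and alternates for
  entries; its value at \<open>s\<close> is the order of the column stabilizer, hence
  nonzero.\<close>

locale submodule_of_module = module R V + sub: submodule N R V
  for R :: "('r, 'x) ring_scheme" (structure) and V :: "('r, 'v, 'y) module_scheme" (structure) and N

sublocale submodule_of_module \<subseteq> abelian_subgroup N V
  by (intro abelian_subgroupI3 additive_subgroupI sub.subgroup_axioms) unfold_locales

context submodule_of_module
begin

abbreviation Q where "Q \<equiv> quotient_module V N"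

lemma quotient_sels:
  "carrier Q = a_rcosets\<^bsub>V\<^esub> N" "zero Q = N" "add Q = set_add V"
  by (simp_all add: quotient_module_def)

lemma quotient_carrier: "carrier Q = (\<lambda>v. N +>\<^bsub>V\<^esub> v) ` carrier V"
  by (auto simp: quotient_sels A_RCOSETS_def' a_r_coset_def' )

lemma coset_in_quotient: "v \<in> carrier V \<Longrightarrow> N +>\<^bsub>V\<^esub> v \<in> carrier Q"
  by (simp add: quotient_carrier)

lemma quotient_add:
  "v \<in> carrier V \<Longrightarrow> w \<in> carrier V \<Longrightarrow> (N +>\<^bsub>V\<^esub> v) \<oplus>\<^bsub>Q\<^esub> (N +>\<^bsub>V\<^esub> w) = N +>\<^bsub>V\<^esub> (v \<oplus>\<^bsub>V\<^esub> w)"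
  by (simp add: quotient_sels a_rcos_sum)

lemma coset_eq_iff:
  assumes "v \<in> carrier V" "w \<in> carrier V"
  shows "N +>\<^bsub>V\<^esub> v = N +>\<^bsub>V\<^esub> w \<longleftrightarrow> v \<ominus>\<^bsub>V\<^esub> w \<in> N"
proof -
  have "v \<ominus>\<^bsub>V\<^esub> w \<in> N \<longleftrightarrow> v \<in> N +>\<^bsub>V\<^esub> w"
    using assms by (simp add: a_rcos_module a_minus_def)
  also have "\<dots> \<longleftrightarrow> N +>\<^bsub>V\<^esub> v = N +>\<^bsub>V\<^esub> w"
    using assms a_repr_independence'[of v w] a_repr_independenceD[of v w] by metis
  finally show ?thesis by simp
qed

text \<open>Scaling the difference of two representatives stays in \<open>N\<close>, so the union in
  \<open>quotient_module\<close> runs over a constant family. It collapses because the coset is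
  inhabited.\<close>

lemma quotient_smult:
  assumes "a \<in> carrier R" "v \<in> carrier V"
  shows "a \<odot>\<^bsub>Q\<^esub> (N +>\<^bsub>V\<^esub> v) = N +>\<^bsub>V\<^esub> (a \<odot>\<^bsub>V\<^esub> v)"
proof -
  have "N +>\<^bsub>V\<^esub> (a \<odot>\<^bsub>V\<^esub> x) = N +>\<^bsub>V\<^esub> (a \<odot>\<^bsub>V\<^esub> v)" if x: "x \<in> N +>\<^bsub>V\<^esub> v" for x
  proof -
    have xc: "x \<in> carrier V" using x assms(2) a_elemrcos_carrier by blast
    have "x \<oplus>\<^bsub>V\<^esub> \<ominus>\<^bsub>V\<^esub> v \<in> N" using a_rcos_module_imp[OF assms(2) x] .
    hence "a \<odot>\<^bsub>V\<^esub> (x \<oplus>\<^bsub>V\<^esub> \<ominus>\<^bsub>V\<^esub> v) \<in> N" using assms by simp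
    thus ?thesis using assms xc
      by (simp add: coset_eq_iff a_minus_def smult_r_distr smult_r_minus)
  qed
  hence "a \<odot>\<^bsub>Q\<^esub> (N +>\<^bsub>V\<^esub> v) = (\<Union>x\<in>N +>\<^bsub>V\<^esub> v. N +>\<^bsub>V\<^esub> (a \<odot>\<^bsub>V\<^esub> v))"
    by (simp add: quotient_module_def)
  moreover have "N +>\<^bsub>V\<^esub> v \<noteq> {}" using a_rcos_self assms by blast
  ultimately show ?thesis by simp
qed

lemma coset_zero: "N +>\<^bsub>V\<^esub> \<zero>\<^bsub>V\<^esub> = zero Q"
  by (simp add: quotient_sels a_subset)

lemma quotient_abelian_group: "abelian_group Q"
proof (rule abelian_groupI)
  show "\<zero>\<^bsub>Q\<^esub> \<in> carrier Q"
    by (simp add: coset_in_quotient flip: coset_zero)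
next
  fix A assume "A \<in> carrier Q"
  then obtain v where v: "v \<in> carrier V" "A = N +>\<^bsub>V\<^esub> v" by (auto simp: quotient_carrier)
  show "\<exists>B\<in>carrier Q. B \<oplus>\<^bsub>Q\<^esub> A = \<zero>\<^bsub>Q\<^esub>"
    using v by (intro bexI[of _ "N +>\<^bsub>V\<^esub> (\<ominus>\<^bsub>V\<^esub> v)"])
      (simp_all add: coset_in_quotient quotient_add l_neg flip: coset_zero)
  show "\<zero>\<^bsub>Q\<^esub> \<oplus>\<^bsub>Q\<^esub> A = A"
    using v by (simp add: quotient_add flip: coset_zero)
next
  fix A B assume "A \<in> carrier Q" "B \<in> carrier Q"
  thus "A \<oplus>\<^bsub>Q\<^esub> B = B \<oplus>\<^bsub>Q\<^esub> A" by (auto simp: quotient_carrier quotient_add M.a_comm)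
qed (auto simp: quotient_carrier quotient_add M.a_assoc)

lemma quotient_module_is_module: "module R Q"
proof (rule moduleI)
  show "cring R" by (rule R.is_cring)
  show "abelian_group Q" by (rule quotient_abelian_group)
qed (auto simp: quotient_carrier quotient_smult quotient_add smult_l_distr smult_r_distr smult_assoc1)

sublocale quot: module R Q by (rule quotient_module_is_module)

lemma coset_hom: "abelian_group_hom V Q (\<lambda>v. N +>\<^bsub>V\<^esub> v)"
proof (intro abelian_group_homI group_hom.intro group_hom_axioms.intro homI)
  show "Group.group (add_monoid V)" "Group.group (add_monoid Q)"
    by (rule M.a_group, rule quot.a_group)
qed (use M.abelian_group_axioms quotient_abelian_group in \<open>simp_all add: coset_in_quotient quotient_add\<close>)

lemma coset_finsum:
  assumes "finite I" "f \<in> I \<rightarrow> carrier V"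
  shows "N +>\<^bsub>V\<^esub> finsum V f I = (\<Oplus>\<^bsub>Q\<^esub>i\<in>I. N +>\<^bsub>V\<^esub> f i)"
  using assms
proof (induction rule: finite_induct)
  case empty
  show ?case by (simp add: quotient_sels a_coset_add_zero a_subset)
next
  case (insert i I)
  hence f: "f i \<in> carrier V" "f \<in> I \<rightarrow> carrier V" "(\<lambda>i. N +>\<^bsub>V\<^esub> f i) \<in> I \<rightarrow> carrier Q"
    by (auto intro: coset_in_quotient)
  have "N +>\<^bsub>V\<^esub> finsum V f (insert i I) = (N +>\<^bsub>V\<^esub> f i) \<oplus>\<^bsub>Q\<^esub> (N +>\<^bsub>V\<^esub> finsum V f I)"
    using insert.hyps f by (simp add: finsum_insert quotient_add)
  also have "\<dots> = (\<Oplus>\<^bsub>Q\<^esub>i\<in>insert i I. N +>\<^bsub>V\<^esub> f i)"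
    using insert.hyps f insert.IH 
    by (subst quot.finsum_insert) (auto intro: coset_in_quotient)
  finally show ?case .
qed

lemma coset_minus:
  assumes "v \<in> carrier V" "w \<in> carrier V"
  shows "N +>\<^bsub>V\<^esub> (v \<ominus>\<^bsub>V\<^esub> w) = (N +>\<^bsub>V\<^esub> v) \<ominus>\<^bsub>Q\<^esub> (N +>\<^bsub>V\<^esub> w)"
  using assms abelian_group_hom.hom_a_inv[OF coset_hom, of w]
  by (simp add: a_minus_def flip: quotient_add)

end

section \<open>Generated submodules, actions on quotients, and the first isomorphism theorem\<close>

text \<open>\<open>hull\<close> intersects all submodules containing \<open>A\<close>. The
  assumption on \<open>A\<close> makes the carrier one of them; for other \<open>A\<close> the
  family is empty and the intersection is \<open>UNIV\<close>.\<close>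

lemma submodule_generated_submodule:
  assumes "module R V" "A \<subseteq> carrier V"
  shows "submodule (generated_submodule R V A) R V"
proof -
  interpret module R V by fact
  have c: "submodule (carrier V) R V" by (rule carrier_is_submodule)
  show ?thesis
    unfolding generated_submodule_def hull_def
  proof (rule submoduleI)
    show "\<Inter>{t. submodule t R V \<and> A \<subseteq> t} \<subseteq> carrier V" using c assms by blast
  qed (use submoduleE(2-5) submodule.axioms(1)[THEN subgroup.one_closed] submoduleE in auto)
qed

text \<open>\<open>group_action\<close> is a homomorphism into \<open>BijGroup\<close>. Bijectivity
  of each map comes from the inverse group element acting as inverse map, and \<open>ext\<close> is
  there because \<open>BijGroup\<close> consists of extensional functions.\<close>

lemma group_actionI:
  assumes "group G"
    and ext: "\<And>g. g \<in> carrier G \<Longrightarrow> \<phi> g \<in> extensional E"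
    and closed: "\<And>g x. g \<in> carrier G \<Longrightarrow> x \<in> E \<Longrightarrow> \<phi> g x \<in> E"
    and one: "\<And>x. x \<in> E \<Longrightarrow> \<phi> \<one>\<^bsub>G\<^esub> x = x"
    and mult: "\<And>g h x. g \<in> carrier G \<Longrightarrow> h \<in> carrier G \<Longrightarrow> x \<in> E \<Longrightarrow> \<phi> (g \<otimes>\<^bsub>G\<^esub> h) x = \<phi> g (\<phi> h x)"
  shows "group_action G E \<phi>"
proof -
  interpret group G by fact
  have bij: "\<phi> g \<in> Bij E" if g: "g \<in> carrier G" for g
  proof -
    have "bij_betw (\<phi> g) E E"
      by (rule bij_betw_byWitness[where f' = "\<phi> (inv\<^bsub>G\<^esub> g)"])
        (use g closed one in \<open>auto simp flip: mult\<close>)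
    thus ?thesis using ext g by (simp add: Bij_def)
  qed
  have "\<phi> (g \<otimes>\<^bsub>G\<^esub> h) = compose E (\<phi> g) (\<phi> h)" if "g \<in> carrier G" "h \<in> carrier G" for g h
    using that ext mult by (intro extensionalityI[of _ E]) (auto simp: compose_def)
  hence "\<phi> \<in> hom G (BijGroup E)"
    using bij by (intro homI) (simp_all add: BijGroup_def)
  thus ?thesis
    by (intro group_action.intro group_hom.intro group_hom_axioms.intro group_BijGroup assms(1))
qed

locale invariant_submodule = linear_representation R V G \<rho> + submodule_of_module R V N
  for R :: "('r, 'x) ring_scheme" and V :: "('r, 'v, 'y) module_scheme"
    and G :: "('g, 'z) monoid_scheme" and \<rho> :: "'g \<Rightarrow> 'v \<Rightarrow> 'v" and N +
  assumes invariant: "g \<in> carrier G \<Longrightarrow> x \<in> N \<Longrightarrow> \<rho> g x \<in> N"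
begin

lemma act_closed: "g \<in> carrier G \<Longrightarrow> v \<in> carrier V \<Longrightarrow> \<rho> g v \<in> carrier V"
  using element_image by blast

lemma act_coset:
  assumes g: "g \<in> carrier G" and v: "v \<in> carrier V"
  shows "\<rho> g ` (N +>\<^bsub>V\<^esub> v) = N +>\<^bsub>V\<^esub> \<rho> g v"
proof -
  interpret G: group G using group_hom by (simp add: group_hom_def)
  have "\<exists>x\<in>N. \<rho> g x = y" if "y \<in> N" for y
  proof
    have y: "y \<in> carrier V" using that by simp
    show "\<rho> (inv\<^bsub>G\<^esub> g) y \<in> N" using invariant g that by simp
    show "\<rho> g (\<rho> (inv\<^bsub>G\<^esub> g) y) = y"
      using orbit_sym_aux[of "inv\<^bsub>G\<^esub> g" y] g y by simp
  qed
  hence N: "\<rho> g ` N = N" using invariant[OF g] by blast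
  have rcos: "N +>\<^bsub>V\<^esub> w = (\<lambda>x. x \<oplus>\<^bsub>V\<^esub> w) ` N" for w by (auto simp: a_r_coset_def')
  have "\<rho> g ` (N +>\<^bsub>V\<^esub> v) = (\<lambda>x. \<rho> g x \<oplus>\<^bsub>V\<^esub> \<rho> g v) ` N"
    unfolding rcos image_image by (intro image_cong) (use act_add g v in simp_all)
  also have "\<dots> = (\<lambda>x. x \<oplus>\<^bsub>V\<^esub> \<rho> g v) ` \<rho> g ` N" by (simp add: image_image)
  finally show ?thesis by (simp add: N rcos)
qed

lemma quotient_act_coset:
  "g \<in> carrier G \<Longrightarrow> v \<in> carrier V \<Longrightarrow> quotient_act V N \<rho> g (N +>\<^bsub>V\<^esub> v) = N +>\<^bsub>V\<^esub> \<rho> g v"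
  by (simp add: quotient_act_def coset_in_quotient act_coset)

lemma quotient_representation: "linear_representation R Q G (quotient_act V N \<rho>)"
proof -
  have "group_action G (carrier Q) (quotient_act V N \<rho>)"
  proof (rule group_actionI)
    show "group G" using group_hom by (simp add: group_hom_def)
    show "quotient_act V N \<rho> g \<in> extensional (carrier Q)" if "g \<in> carrier G" for g
      by (simp add: quotient_act_def)
    have "\<one>\<^bsub>G\<^esub> \<in> carrier G" using \<open>group G\<close> by (simp add: group.is_monoid monoid.one_closed)
    show "quotient_act V N \<rho> \<one>\<^bsub>G\<^esub> A = A" if "A \<in> carrier Q" for A
      using that \<open>\<one>\<^bsub>G\<^esub> \<in> carrier G\<close> id_eq_one[symmetric]
      by (auto simp: quotient_carrier quotient_act_coset)
    show "quotient_act V N \<rho> (g \<otimes>\<^bsub>G\<^esub> h) A = quotient_act V N \<rho> g (quotient_act V N \<rho> h A)"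
      if "g \<in> carrier G" "h \<in> carrier G" "A \<in> carrier Q" for g h A
      using that \<open>group G\<close>
      by (auto simp: quotient_carrier quotient_act_coset act_closed composition_rule group.is_monoid monoid.m_closed)
  qed (auto simp: quotient_carrier quotient_act_coset act_closed)
  thus ?thesis
    by (intro linear_representation.intro linear_representation_axioms.intro quotient_module_is_module)
      (auto simp: quotient_carrier quotient_act_coset quotient_add quotient_smult act_closed act_add act_smult)
qed

end

text \<open>The vectors that \<open>\<rho> g\<close> sends into the generated submodule form a
  submodule themselves, so the generators decide.\<close>

lemma (in linear_representation) generated_submodule_invariant:
  assumes A: "A \<subseteq> carrier V"
    and inv: "\<And>g x. g \<in> carrier G \<Longrightarrow> x \<in> A \<Longrightarrow> \<rho> g x \<in> generated_submodule R V A"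
  shows "invariant_submodule R V G \<rho> (generated_submodule R V A)"
proof -
  have sub: "submodule (generated_submodule R V A) R V"
    by (intro submodule_generated_submodule A module_axioms)
  interpret S: submodule_of_module R V "generated_submodule R V A"
    using sub by (intro submodule_of_module.intro module_axioms)
  have "\<rho> g x \<in> generated_submodule R V A"
    if g: "g \<in> carrier G" and x: "x \<in> generated_submodule R V A" for g x
  proof -
    let ?P = "{x \<in> carrier V. \<rho> g x \<in> generated_submodule R V A}"
    have add0: "\<rho> g \<zero>\<^bsub>V\<^esub> = \<zero>\<^bsub>V\<^esub>"
      using act_smult[OF g R.zero_closed M.zero_closed] element_image[OF g M.zero_closed] by simp
    have "submodule ?P R V"
    proof (rule submoduleI)
      fix a assume a: "a \<in> ?P"
      hence "\<rho> g (\<ominus>\<^bsub>V\<^esub> a) = \<ominus>\<^bsub>V\<^esub> \<rho> g a"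
        using act_smult[of g "\<ominus>\<^bsub>R\<^esub> \<one>\<^bsub>R\<^esub>" a] element_image[OF g, of a] g
        by (simp add: smult_l_minus)
      thus "\<ominus>\<^bsub>V\<^esub> a \<in> ?P" using a by simp
    qed (use g add0 act_add act_smult in auto)
    moreover have "A \<subseteq> ?P" using A inv g by auto
    ultimately have "generated_submodule R V A \<subseteq> ?P"
      unfolding generated_submodule_def by (rule hull_minimal[rotated])
    thus ?thesis using x by auto
  qed
  thus ?thesis
    by (intro invariant_submodule.intro invariant_submodule_axioms.intro
        linear_representation_axioms S.submodule_of_module_axioms)
qed

text \<open>\<open>h\<close> is constant on the coset, so the image is a singleton. Induced maps
  defined by \<open>the_elem\<close> avoid a choice of representatives; this serves both the first
  isomorphism theorem and the descent to \<open>column_module\<close>.\<close>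

lemma (in submodule_of_module) the_elem_image_coset:
  assumes add: "\<And>v w. v \<in> carrier V \<Longrightarrow> w \<in> carrier V \<Longrightarrow> h (v \<oplus>\<^bsub>V\<^esub> w) = h v \<oplus>\<^bsub>W\<^esub> h w"
    and h: "h \<in> carrier V \<rightarrow> carrier W" and W: "abelian_group W"
    and kernel: "\<And>v. v \<in> N \<Longrightarrow> h v = \<zero>\<^bsub>W\<^esub>"
    and v: "v \<in> carrier V"
  shows "the_elem (h ` (N +>\<^bsub>V\<^esub> v)) = h v"
proof -
  interpret W: abelian_group W by fact
  have "h (x \<oplus>\<^bsub>V\<^esub> v) = h v" if "x \<in> N" for x
    using that v funcset_mem[OF h v] kernel add[of x v] by simp
  moreover have "N +>\<^bsub>V\<^esub> v = (\<lambda>x. x \<oplus>\<^bsub>V\<^esub> v) ` N" by (auto simp: a_r_coset_def')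
  ultimately have "h ` (N +>\<^bsub>V\<^esub> v) = (\<lambda>_. h v) ` N" by (simp add: image_image)
  moreover have "N \<noteq> {}" using sub.one_closed by blast
  ultimately show ?thesis by (simp add: image_constant_conv)
qed

lemma (in invariant_submodule) restrict_representation:
  "linear_representation R (V\<lparr>carrier := N\<rparr>) G (\<lambda>g. restrict (\<rho> g) N)"
proof -
  have "group_action G N (\<lambda>g. restrict (\<rho> g) N)"
  proof (rule group_actionI)
    show "Group.group G" using group_hom by (simp add: group_hom_def)
    then interpret G: Group.group G .
    show "restrict (\<rho> \<one>\<^bsub>G\<^esub>) N x = x" if "x \<in> N" for x
      using that id_eq_one[symmetric] by simp
    show "restrict (\<rho> (g \<otimes>\<^bsub>G\<^esub> h)) N x = restrict (\<rho> g) N (restrict (\<rho> h) N x)"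
      if "g \<in> carrier G" "h \<in> carrier G" "x \<in> N" for g h x
      using that by (simp add: invariant composition_rule)
  qed (simp_all add: invariant)
  moreover have "module R (V\<lparr>carrier := N\<rparr>)"
    by (rule sub.submodule_is_module) (rule module_axioms)
  ultimately show ?thesis
    by (intro linear_representation.intro linear_representation_axioms.intro)
      (simp_all add: act_add act_smult sub.m_closed[simplified])
qed

lemma (in invariant_submodule) first_isomorphism:
  assumes W: "linear_representation R W G \<tau>"
    and h: "h \<in> carrier V \<rightarrow> carrier W"
    and add: "\<And>v w. v \<in> carrier V \<Longrightarrow> w \<in> carrier V \<Longrightarrow> h (v \<oplus>\<^bsub>V\<^esub> w) = h v \<oplus>\<^bsub>W\<^esub> h w"
    and smult: "\<And>a v. a \<in> carrier R \<Longrightarrow> v \<in> carrier V \<Longrightarrow> h (a \<odot>\<^bsub>V\<^esub> v) = a \<odot>\<^bsub>W\<^esub> h v"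
    and act: "\<And>g v. g \<in> carrier G \<Longrightarrow> v \<in> carrier V \<Longrightarrow> h (\<rho> g v) = \<tau> g (h v)"
    and onto: "carrier W \<subseteq> h ` carrier V"
    and kernel: "\<And>v. v \<in> carrier V \<Longrightarrow> h v = \<zero>\<^bsub>W\<^esub> \<longleftrightarrow> v \<in> N"
  shows "isomorphic_representations R G Q (quotient_act V N \<rho>) W \<tau>"
proof -
  interpret W: linear_representation R W G \<tau> by fact
  interpret h: abelian_group_hom V W h
    using h add
    by (intro abelian_group_homI W.M.abelian_group_axioms M.abelian_group_axioms group_hom.intro
        group_hom_axioms.intro M.a_group W.M.a_group homI) auto
  define \<phi> where "\<phi> A = the_elem (h ` A)" for A
  have h_eq: "h v = h w \<longleftrightarrow> N +>\<^bsub>V\<^esub> v = N +>\<^bsub>V\<^esub> w" if "v \<in> carrier V" "w \<in> carrier V" for v w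
  proof -
    have hc: "h v \<in> carrier W" "h w \<in> carrier W" using that h by auto
    have "h v = h w \<longleftrightarrow> h v \<oplus>\<^bsub>W\<^esub> \<ominus>\<^bsub>W\<^esub> h w = \<zero>\<^bsub>W\<^esub>"
      using hc W.M.minus_equality[of "h v" "\<ominus>\<^bsub>W\<^esub> h w"] W.M.r_neg by auto
    also have "\<dots> \<longleftrightarrow> v \<ominus>\<^bsub>V\<^esub> w \<in> N"
      using that kernel[of "v \<ominus>\<^bsub>V\<^esub> w"] by (simp add: a_minus_def)
    finally show ?thesis using that by (simp add: coset_eq_iff)
  qed
  have \<phi>: "\<phi> (N +>\<^bsub>V\<^esub> v) = h v" if "v \<in> carrier V" for v
    unfolding \<phi>_def by (rule the_elem_image_coset[of h W]) (use that add h kernel W.M.abelian_group_axioms in auto)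
  have "\<phi> \<in> hom (add_monoid Q) (add_monoid W)"
    using h by (intro homI) (auto simp: quotient_carrier \<phi> quotient_add add)
  moreover have "inj_on \<phi> (carrier Q)"
    by (rule inj_onI) (auto simp: quotient_carrier \<phi> h_eq)
  moreover have "\<phi> ` carrier Q = carrier W"
  proof -
    have "\<phi> ` carrier Q = h ` carrier V"
      unfolding quotient_carrier image_image by (intro image_cong) (simp_all add: \<phi>)
    thus ?thesis using onto h by auto
  qed
  ultimately have "\<phi> \<in> iso (add_monoid Q) (add_monoid W)"
    by (simp add: iso_def bij_betw_def)
  moreover have "\<forall>a\<in>carrier R. \<forall>v\<in>carrier Q. \<phi> (a \<odot>\<^bsub>Q\<^esub> v) = a \<odot>\<^bsub>W\<^esub> \<phi> v"
    by (auto simp: quotient_carrier quotient_smult \<phi> smult)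
  moreover have "\<forall>g\<in>carrier G. \<forall>v\<in>carrier Q. \<phi> (quotient_act V N \<rho> g v) = \<tau> g (\<phi> v)"
    by (auto simp: quotient_carrier quotient_act_coset \<phi> act act_closed)
  ultimately show ?thesis
    using W quotient_representation by (auto simp: isomorphic_representations_def)
qed

section \<open>Linear extension to free modules\<close>

abbreviation "lookup \<equiv> Poly_Mapping.lookup"
abbreviation "keys \<equiv> Poly_Mapping.keys"

lemma lookup_scale [simp]: "lookup (Poly_Mapping.map ((*) a) p) k = (a :: complex) * lookup p k"
  by (simp add: Poly_Mapping.map.rep_eq when_def)

definition linear_extension :: "('a \<Rightarrow> 'b \<Rightarrow>\<^sub>0 complex) \<Rightarrow> ('a \<Rightarrow>\<^sub>0 complex) \<Rightarrow> 'b \<Rightarrow>\<^sub>0 complex"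
  where "linear_extension \<phi> f = (\<Sum>x\<in>keys f. Poly_Mapping.map ((*) (lookup f x)) (\<phi> x))"

text \<open>Additivity needs one index set for \<open>f\<close>, \<open>g\<close> and
  \<open>f + g\<close>, although keys may cancel in the sum; any finite superset of the keys will
  do.\<close>

lemma lookup_linear_extension:
  assumes "finite S" "keys f \<subseteq> S"
  shows "lookup (linear_extension \<phi> f) y = (\<Sum>x\<in>S. lookup f x * lookup (\<phi> x) y)"
  unfolding linear_extension_def lookup_sum
  by (rule sum.mono_neutral_cong_left) (use assms in \<open>auto simp: in_keys_iff\<close>)

lemma linear_extension_add:
  "linear_extension \<phi> (f + g) = linear_extension \<phi> f + linear_extension \<phi> g"
proof (rule poly_mapping_eqI)
  fix y
  have *: "finite (keys f \<union> keys g)" "keys (f + g) \<subseteq> keys f \<union> keys g"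
    "keys f \<subseteq> keys f \<union> keys g" "keys g \<subseteq> keys f \<union> keys g"
    using keys_add[of f g] by auto
  show "lookup (linear_extension \<phi> (f + g)) y = lookup (linear_extension \<phi> f + linear_extension \<phi> g) y"
    unfolding lookup_add *(2-4)[THEN lookup_linear_extension[OF *(1)]]
    by (simp add: ring_distribs sum.distrib)
qed

lemma keys_scale: "keys (Poly_Mapping.map ((*) (a :: complex)) f) \<subseteq> keys f"
  by (auto simp: in_keys_iff)

lemma linear_extension_scale:
  "linear_extension \<phi> (Poly_Mapping.map ((*) a) f) = Poly_Mapping.map ((*) a) (linear_extension \<phi> f)"
proof (rule poly_mapping_eqI)
  fix y
  show "lookup (linear_extension \<phi> (Poly_Mapping.map ((*) a) f)) y
    = lookup (Poly_Mapping.map ((*) a) (linear_extension \<phi> f)) y"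
    by (subst lookup_linear_extension[OF finite_keys keys_scale])
      (simp add: lookup_linear_extension[OF finite_keys order_refl] sum_distrib_left mult.assoc)
qed

lemma linear_extension_single [simp]:
  "linear_extension \<phi> (Poly_Mapping.single x a) = Poly_Mapping.map ((*) a) (\<phi> x)"
proof (rule poly_mapping_eqI)
  fix y
  show "lookup (linear_extension \<phi> (Poly_Mapping.single x a)) y = lookup (Poly_Mapping.map ((*) a) (\<phi> x)) y"
    by (subst lookup_linear_extension[of "{x}"]) (auto simp: in_keys_iff lookup_single when_def)
qed

lemma scale_one [simp]: "Poly_Mapping.map ((*) (1 :: complex)) f = f"
  by (rule poly_mapping_eqI) simp

lemma linear_extension_zero [simp]: "linear_extension \<phi> 0 = 0"
  by (simp add: linear_extension_def)

lemma linear_extension_uminus: "linear_extension \<phi> (- f) = - linear_extension \<phi> f"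
  using linear_extension_add[of \<phi> f "- f"] by (simp add: eq_neg_iff_add_eq_0 add.commute)

lemma linear_extension_diff:
  "linear_extension \<phi> (f - g) = linear_extension \<phi> f - linear_extension \<phi> g"
  using linear_extension_add[of \<phi> f "- g"] by (simp add: linear_extension_uminus)

lemma linear_extension_sum:
  "linear_extension \<phi> (\<Sum>i\<in>I. f i) = (\<Sum>i\<in>I. linear_extension \<phi> (f i))"
  by (induction I rule: infinite_finite_induct) (simp_all add: linear_extension_add)

lemma linear_extension_cong:
  "(\<And>x. x \<in> keys f \<Longrightarrow> \<phi> x = \<psi> x) \<Longrightarrow> linear_extension \<phi> f = linear_extension \<psi> f"
  by (simp add: linear_extension_def)

lemma linear_extension_linear_extension:
  "linear_extension \<psi> (linear_extension \<phi> f) = linear_extension (\<lambda>x. linear_extension \<psi> (\<phi> x)) f"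
  unfolding linear_extension_def[of \<phi>] linear_extension_sum linear_extension_scale
  by (simp add: linear_extension_def)

lemma linear_extension_id: "linear_extension (\<lambda>x. Poly_Mapping.single x 1) f = f"
proof (rule poly_mapping_eqI)
  fix y
  show "lookup (linear_extension (\<lambda>x. Poly_Mapping.single x 1) f) y = lookup f y"
    by (subst lookup_linear_extension[of "insert y (keys f)"])
      (auto simp: lookup_single when_def if_distrib[of "(*) _"] in_keys_iff cong: if_cong)
qed

lemma keys_linear_extension:
  assumes "\<And>x. x \<in> keys f \<Longrightarrow> keys (\<phi> x) \<subseteq> B"
  shows "keys (linear_extension \<phi> f) \<subseteq> B"
proof
  fix y assume "y \<in> keys (linear_extension \<phi> f)"
  hence "(\<Sum>x\<in>keys f. lookup f x * lookup (\<phi> x) y) \<noteq> 0"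
    by (simp add: in_keys_iff lookup_linear_extension[OF finite_keys order_refl])
  then obtain x where "x \<in> keys f" "y \<in> keys (\<phi> x)"
    by (auto simp: in_keys_iff elim: sum.not_neutral_contains_not_neutral)
  thus "y \<in> B" using assms by blast
qed

section \<open>Free modules and the permutation representations on them\<close>

lemma free_module_sels [simp]:
  "carrier (free_module A) = {f. keys f \<subseteq> A}" "\<zero>\<^bsub>free_module A\<^esub> = 0"
  "f \<oplus>\<^bsub>free_module A\<^esub> g = f + g" "a \<odot>\<^bsub>free_module A\<^esub> f = Poly_Mapping.map ((*) a) f"
  by (simp_all add: free_module_def)

lemma complex_ring_sels [simp]:
  "carrier complex_ring = UNIV" "\<zero>\<^bsub>complex_ring\<^esub> = 0" "\<one>\<^bsub>complex_ring\<^esub> = 1"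
  "a \<oplus>\<^bsub>complex_ring\<^esub> b = a + b" "a \<otimes>\<^bsub>complex_ring\<^esub> b = a * b"
  by (simp_all add: ring_of_type_algebra_def)

lemma module_free_module: "module complex_ring (free_module A)"
proof (rule moduleI)
  show "cring complex_ring" by (rule cring_from_type_algebra)
  show "abelian_group (free_module A)"
  proof (rule abelian_groupI)
    fix f assume "f \<in> carrier (free_module A)"
    thus "\<exists>g\<in>carrier (free_module A). g \<oplus>\<^bsub>free_module A\<^esub> f = \<zero>\<^bsub>free_module A\<^esub>"
      by (intro bexI[of _ "- f"]) (auto simp: in_keys_iff)
  qed (use keys_add in \<open>fastforce simp: algebra_simps\<close>)+
qed (use keys_scale in \<open>fastforce intro!: poly_mapping_eqI simp: lookup_add algebra_simps\<close>)+

interpretation free_module: module complex_ring "free_module A" for A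
  by (rule module_free_module)

lemma free_module_a_inv [simp]:
  "keys f \<subseteq> A \<Longrightarrow> \<ominus>\<^bsub>free_module A\<^esub> f = - f"
  by (rule free_module.M.minus_equality) (auto simp: in_keys_iff)

lemma free_module_a_minus [simp]:
  "keys f \<subseteq> A \<Longrightarrow> keys g \<subseteq> A \<Longrightarrow> f \<ominus>\<^bsub>free_module A\<^esub> g = f - g"
  by (simp add: a_minus_def)

lemma free_module_finsum:
  assumes "finite I" "\<And>i. i \<in> I \<Longrightarrow> keys (f i) \<subseteq> A"
  shows "finsum (free_module A) f I = (\<Sum>i\<in>I. f i)"
  using assms
proof (induction rule: finite_induct)
  case (insert i I)
  thus ?case by (subst free_module.M.finsum_insert) (auto simp: Pi_def)
qed simp

text \<open>Exhibits the action as the linear extension of a permutation of the basis, so that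
  composition laws and equivariance reduce to basis elements.\<close>

lemma free_act_eq:
  "keys f \<subseteq> A \<Longrightarrow> free_act A \<alpha> g f = linear_extension (\<lambda>x. Poly_Mapping.single (\<alpha> g x) 1) f"
  by (simp add: free_act_def linear_extension_def)

lemma free_representation:
  assumes G: "Group.group G"
    and closed: "\<And>g x. g \<in> carrier G \<Longrightarrow> x \<in> A \<Longrightarrow> \<alpha> g x \<in> A"
    and one: "\<And>x. x \<in> A \<Longrightarrow> \<alpha> \<one>\<^bsub>G\<^esub> x = x"
    and mult: "\<And>g h x. g \<in> carrier G \<Longrightarrow> h \<in> carrier G \<Longrightarrow> x \<in> A \<Longrightarrow> \<alpha> (g \<otimes>\<^bsub>G\<^esub> h) x = \<alpha> g (\<alpha> h x)"
  shows "linear_representation complex_ring (free_module A) G (free_act A \<alpha>)"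
proof -
  interpret G: Group.group G by fact
  have keys: "keys (linear_extension (\<lambda>x. Poly_Mapping.single (\<alpha> g x) 1) f) \<subseteq> A"
    if "g \<in> carrier G" "keys f \<subseteq> A" for g f
    by (rule keys_linear_extension) (use that closed in auto)
  have "group_action G (carrier (free_module A)) (free_act A \<alpha>)"
  proof (rule group_actionI[OF G])
    show "free_act A \<alpha> g \<in> extensional (carrier (free_module A))" for g
      by (simp add: free_act_def)
    show "free_act A \<alpha> g f \<in> carrier (free_module A)" if "g \<in> carrier G" "f \<in> carrier (free_module A)" for g f
      using that keys by (simp add: free_act_eq)
    show "free_act A \<alpha> \<one>\<^bsub>G\<^esub> f = f" if "f \<in> carrier (free_module A)" for f
    proof -
      have "linear_extension (\<lambda>x. Poly_Mapping.single (\<alpha> \<one>\<^bsub>G\<^esub> x) 1) f = linear_extension (\<lambda>x. Poly_Mapping.single x 1) f"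
        using that one by (intro linear_extension_cong) auto
      thus ?thesis using that by (simp add: free_act_eq linear_extension_id)
    qed
    show "free_act A \<alpha> (g \<otimes>\<^bsub>G\<^esub> h) f = free_act A \<alpha> g (free_act A \<alpha> h f)"
      if "g \<in> carrier G" "h \<in> carrier G" "f \<in> carrier (free_module A)" for g h f
      using that keys mult
      by (simp add: free_act_eq linear_extension_linear_extension)
        (intro linear_extension_cong, auto)
  qed
  moreover have "free_act A \<alpha> g (f + f') = free_act A \<alpha> g f + free_act A \<alpha> g f'"
    if "keys f \<subseteq> A" "keys f' \<subseteq> A" for g f f'
    using that keys_add[of f f'] by (subst (1 2 3) free_act_eq) (auto simp: linear_extension_add)
  moreover have "free_act A \<alpha> g (Poly_Mapping.map ((*) a) f) = Poly_Mapping.map ((*) a) (free_act A \<alpha> g f)"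
    if "keys f \<subseteq> A" for g f a
    using that keys_scale[of a f] by (subst (1 2) free_act_eq) (auto simp: linear_extension_scale)
  ultimately show ?thesis
    by (intro linear_representation.intro linear_representation_axioms.intro module_free_module) auto
qed

section \<open>Tableaux and polytabloids\<close>

lemma finite_diagram: "finite (diagram lam)"
proof (rule finite_subset)
  show "diagram lam \<subseteq> {..length lam} \<times> {..Max (insert 0 (set lam))}"
    by (auto simp: diagram_def intro!: order_trans[OF _ Max_ge])
qed auto

lemma diagram_column_subset: "diagram_column lam c \<subseteq> diagram lam"
  by (auto simp: diagram_column_def)

lemma finite_diagram_column: "finite (diagram_column lam c)"
  using finite_subset[OF diagram_column_subset finite_diagram] .

lemma column_in_diagram: "x \<in> diagram_column lam c \<Longrightarrow> x \<in> diagram lam"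
  by (auto simp: diagram_column_def)

lemma columns_disjoint: "x \<in> diagram_column lam c \<Longrightarrow> x \<in> diagram_column lam c' \<Longrightarrow> c = c'"
  by (auto simp: diagram_column_def)

lemma tableaux_bij: "t \<in> tableaux lam \<Longrightarrow> bij_betw t (diagram lam) {1..sum_list lam}"
  by (simp add: tableaux_def)

lemma tableaux_inj: "t \<in> tableaux lam \<Longrightarrow> inj_on t (diagram lam)"
  by (simp add: tableaux_def bij_betw_def)

lemma tableaux_entry:
  "t \<in> tableaux lam \<Longrightarrow> x \<in> diagram lam \<Longrightarrow> t x \<in> {1..sum_list lam}"
  using tableaux_bij[of t lam] by (auto simp: bij_betw_def)

lemma finite_tableaux: "finite (tableaux lam)"
proof (rule finite_subset)
  show "tableaux lam \<subseteq> {t. \<forall>x. (x \<in> diagram lam \<longrightarrow> t x \<in> {1..sum_list lam}) \<and> (x \<notin> diagram lam \<longrightarrow> t x = 0)}"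
    using tableaux_entry by (auto simp: tableaux_def dest: bij_betwE)
  show "finite \<dots>"
    by (rule finite_set_of_finite_funs) (auto intro: finite_diagram)
qed

lemma permutes_comp_tableau:
  assumes "g permutes {1..sum_list lam}" "t \<in> tableaux lam"
  shows "g \<circ> t \<in> tableaux lam"
proof -
  have "g 0 = 0" using assms(1) by (auto simp: permutes_def)
  moreover have "bij_betw (g \<circ> t) (diagram lam) {1..sum_list lam}"
    by (rule bij_betw_trans[OF tableaux_bij[OF assms(2)] permutes_imp_bij[OF assms(1)]])
  ultimately show ?thesis using assms(2) by (auto simp: tableaux_def)
qed

text \<open>Here \<open>z\<close> ranges over all cells: off the diagram the entry is the dummy
  value 0, which no cell of the diagram carries.\<close>

lemma tableau_entry_eq_iff:
  assumes "t \<in> tableaux lam" "x \<in> diagram lam"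
  shows "t z = t x \<longleftrightarrow> z = x"
proof (cases "z \<in> diagram lam")
  case True
  thus ?thesis using assms tableaux_inj by (meson inj_on_eq_iff)
next
  case False
  hence "t z = 0" using assms(1) by (cases z) (simp add: tableaux_def)
  thus ?thesis using False tableaux_entry[OF assms] assms(2) by auto
qed

text \<open>The bridge between permuting cells and permuting entries. The relations are written with
  cells, where they commute with the group action; column stabilizers and their signs live on
  entries.\<close>

lemma switch_eq_comp:
  assumes "t \<in> tableaux lam" "x \<in> diagram lam" "y \<in> diagram lam"
  shows "switch x y t = Transposition.transpose (t x) (t y) \<circ> t"
  using assms by (auto simp: fun_eq_iff switch_def Transposition.transpose_def tableau_entry_eq_iff)

lemma permutes_transpose_entries:
  assumes "t \<in> tableaux lam" "x \<in> diagram lam" "y \<in> diagram lam"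
  shows "Transposition.transpose (t x) (t y) permutes {1..sum_list lam}"
  using assms tableaux_entry by (intro permutes_swap_id) auto

lemma switch_tableaux:
  assumes "t \<in> tableaux lam" "x \<in> diagram lam" "y \<in> diagram lam"
  shows "switch x y t \<in> tableaux lam"
  using permutes_comp_tableau permutes_transpose_entries assms switch_eq_comp by metis

lemma switch_switch [simp]: "switch x y (switch x y t) = t"
  by (simp add: switch_def comp_assoc)

section \<open>Column stabilizers\<close>

lemma column_stabilizer_iff:
  "q \<in> column_stabilizer lam t \<longleftrightarrow> q permutes {1..sum_list lam} \<and>
    (\<forall>c. q ` t ` diagram_column lam c = t ` diagram_column lam c)"
  by (simp add: column_stabilizer_def sym_group_carrier)

lemma column_stabilizerD:
  assumes "q \<in> column_stabilizer lam t"
  shows "q permutes {1..sum_list lam}" "permutation q" "q ` t ` diagram_column lam c = t ` diagram_column lam c"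
  using assms by (auto simp: column_stabilizer_iff permutation_permutes)

lemma finite_column_stabilizer: "finite (column_stabilizer lam t)"
  by (rule finite_subset[OF _ finite_permutations[of "{1..sum_list lam}"]])
    (auto simp: column_stabilizer_iff)

lemma id_column_stabilizer: "id \<in> column_stabilizer lam t"
  by (simp add: column_stabilizer_iff permutes_id)

lemma comp_column_stabilizer:
  "p \<in> column_stabilizer lam t \<Longrightarrow> q \<in> column_stabilizer lam t \<Longrightarrow> p \<circ> q \<in> column_stabilizer lam t"
  unfolding column_stabilizer_iff image_comp[of p q, symmetric] by (metis permutes_compose)

lemma inv_column_stabilizer:
  assumes "q \<in> column_stabilizer lam t"
  shows "inv' q \<in> column_stabilizer lam t"
proof -
  have "inv' q ` t ` diagram_column lam c = t ` diagram_column lam c" for c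
  proof -
    have "inv' q ` t ` diagram_column lam c = inv' q ` q ` t ` diagram_column lam c"
      using column_stabilizerD(3)[OF assms] by simp
    also have "\<dots> = t ` diagram_column lam c"
      using permutes_inj[OF column_stabilizerD(1)[OF assms]] by (simp add: image_image)
    finally show ?thesis .
  qed
  thus ?thesis using column_stabilizerD(1)[OF assms] by (simp add: column_stabilizer_iff permutes_inv)
qed

lemma transpose_column_stabilizer:
  assumes "t \<in> tableaux lam" "a \<in> t ` diagram_column lam c" "b \<in> t ` diagram_column lam c"
  shows "Transposition.transpose a b \<in> column_stabilizer lam t"
proof -
  obtain x y where xy: "x \<in> diagram_column lam c" "y \<in> diagram_column lam c" "a = t x" "b = t y"
    using assms by auto
  have "Transposition.transpose a b ` t ` diagram_column lam d = t ` diagram_column lam d" for d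
  proof (cases "d = c")
    case True
    show ?thesis unfolding True by (rule transpose_image_eq) (use assms(2,3) in simp)
  next
    case False
    have "a \<notin> t ` diagram_column lam d" "b \<notin> t ` diagram_column lam d"
      using False xy tableaux_inj[OF assms(1)] column_in_diagram columns_disjoint
      by (metis (no_types, lifting) imageE inj_onD)+
    thus ?thesis by (simp add: transpose_image_eq)
  qed
  thus ?thesis
    using permutes_transpose_entries[OF assms(1)] xy column_in_diagram by (auto simp: column_stabilizer_iff)
qed

lemma column_stabilizer_comp:
  assumes g: "g permutes {1..sum_list lam}"
  shows "bij_betw (\<lambda>q. g \<circ> q \<circ> inv' g) (column_stabilizer lam t) (column_stabilizer lam (g \<circ> t))"
proof (rule bij_betw_byWitness[where f' = "\<lambda>q. inv' g \<circ> q \<circ> g"])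
  have gi: "inv' g \<circ> g = id" "g \<circ> inv' g = id" using permutes_inv_o[OF g] by auto
  have gi': "inv' g (g z) = z" "g (inv' g z) = z" for z
    using gi[THEN fun_cong, of z] by simp_all
  show "\<forall>q\<in>column_stabilizer lam t. inv' g \<circ> (g \<circ> q \<circ> inv' g) \<circ> g = q"
    "\<forall>q\<in>column_stabilizer lam (g \<circ> t). g \<circ> (inv' g \<circ> q \<circ> g) \<circ> inv' g = q"
    by (auto simp: fun_eq_iff gi')
  show "(\<lambda>q. g \<circ> q \<circ> inv' g) ` column_stabilizer lam t \<subseteq> column_stabilizer lam (g \<circ> t)"
  proof safe
    fix q assume q: "q \<in> column_stabilizer lam t"
    have "(g \<circ> q \<circ> inv' g) ` (g \<circ> t) ` diagram_column lam c = (g \<circ> t) ` diagram_column lam c" for c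
    proof -
      have "(g \<circ> q \<circ> inv' g) ` (g \<circ> t) ` diagram_column lam c = g ` q ` t ` diagram_column lam c"
        by (simp add: image_image gi')
      also have "\<dots> = (g \<circ> t) ` diagram_column lam c"
        unfolding column_stabilizerD(3)[OF q] by (simp add: image_image)
      finally show ?thesis .
    qed
    thus "g \<circ> q \<circ> inv' g \<in> column_stabilizer lam (g \<circ> t)"
      using g column_stabilizerD(1)[OF q] by (simp add: column_stabilizer_iff permutes_compose permutes_inv)
  qed
  show "(\<lambda>q. inv' g \<circ> q \<circ> g) ` column_stabilizer lam (g \<circ> t) \<subseteq> column_stabilizer lam t"
  proof safe
    fix q assume q: "q \<in> column_stabilizer lam (g \<circ> t)"
    have "(inv' g \<circ> q \<circ> g) ` t ` diagram_column lam c = t ` diagram_column lam c" for c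
    proof -
      have "(inv' g \<circ> q \<circ> g) ` t ` diagram_column lam c = inv' g ` q ` (g \<circ> t) ` diagram_column lam c"
        by (simp add: image_image)
      also have "\<dots> = t ` diagram_column lam c"
        unfolding column_stabilizerD(3)[OF q] by (simp add: image_image gi')
      finally show ?thesis .
    qed
    thus "inv' g \<circ> q \<circ> g \<in> column_stabilizer lam t"
      using g column_stabilizerD(1)[OF q] by (simp add: column_stabilizer_iff permutes_compose permutes_inv)
  qed
qed

section \<open>Polytabloids and tabloids under permutations of entries\<close>

lemma sign_conjugate:
  assumes "permutation g" "permutation q"
  shows "sign (g \<circ> q \<circ> inv' g) = sign q"
  using assms by (simp add: sign_compose permutation_compose permutation_inverse sign_inverse)

text \<open>Conjugation by \<open>g\<close> carries the stabilizer of \<open>t\<close> to that of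
  \<open>g \<circ> t\<close> and preserves signs; the conjugating factor then cancels against
  \<open>g\<close>. The index set becomes independent of \<open>g\<close>, so polytabloids of
  different switches of \<open>t\<close> can be compared term by term.\<close>

lemma polytabloid_comp:
  assumes g: "g permutes {1..sum_list lam}"
  shows "polytabloid lam (g \<circ> t) = (\<Sum>q\<in>column_stabilizer lam t.
    Poly_Mapping.single (tabloid lam (g \<circ> q \<circ> t)) (of_int (sign q)))"
proof -
  have gi: "inv' g \<circ> g = id" using permutes_inv_o[OF g] by auto
  have pg: "permutation g" using g by (auto simp: permutation_permutes)
  have "polytabloid lam (g \<circ> t) = (\<Sum>q\<in>column_stabilizer lam t.
    Poly_Mapping.single (tabloid lam (g \<circ> q \<circ> inv' g \<circ> (g \<circ> t))) (of_int (sign (g \<circ> q \<circ> inv' g))))"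
    unfolding polytabloid_def tableau_act_def
    by (rule sum.reindex_bij_betw[OF column_stabilizer_comp[OF g], symmetric])
  also have "\<dots> = (\<Sum>q\<in>column_stabilizer lam t.
    Poly_Mapping.single (tabloid lam (g \<circ> q \<circ> t)) (of_int (sign q)))"
  proof (intro sum.cong refl)
    fix q assume "q \<in> column_stabilizer lam t"
    moreover have "g \<circ> q \<circ> inv' g \<circ> (g \<circ> t) = g \<circ> q \<circ> t"
      using gi by (simp add: fun_eq_iff)
    ultimately show "Poly_Mapping.single (tabloid lam (g \<circ> q \<circ> inv' g \<circ> (g \<circ> t))) (of_int (sign (g \<circ> q \<circ> inv' g)) :: complex)
      = Poly_Mapping.single (tabloid lam (g \<circ> q \<circ> t)) (of_int (sign q))"
      using pg column_stabilizerD(2) by (simp add: sign_conjugate)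
  qed
  finally show ?thesis .
qed

text \<open>Left multiplication by \<open>q\<close> permutes the stabilizer and multiplies every
  sign by \<open>sign q\<close>, which is its own inverse.\<close>

lemma polytabloid_column:
  assumes q: "q \<in> column_stabilizer lam t"
  shows "polytabloid lam (q \<circ> t) = Poly_Mapping.map ((*) (of_int (sign q))) (polytabloid lam t)"
proof -
  have bij: "bij_betw ((\<circ>) q) (column_stabilizer lam t) (column_stabilizer lam t)"
    by (rule bij_betw_byWitness[where f' = "(\<circ>) (inv' q)"])
      (use q in \<open>auto simp: comp_column_stabilizer inv_column_stabilizer o_assoc
        permutes_inv_o[OF column_stabilizerD(1)[OF q]]\<close>)
  show ?thesis
  proof (rule poly_mapping_eqI)
    fix U
    have "lookup (Poly_Mapping.map ((*) (of_int (sign q))) (polytabloid lam t)) U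
      = (\<Sum>p\<in>column_stabilizer lam t. of_int (sign q) * (of_int (sign p) when tabloid lam (p \<circ> t) = U))"
      by (simp add: polytabloid_def tableau_act_def lookup_sum lookup_single sum_distrib_left)
    also have "\<dots> = (\<Sum>p\<in>column_stabilizer lam t. of_int (sign q) * (of_int (sign (q \<circ> p)) when tabloid lam (q \<circ> p \<circ> t) = U))"
      by (rule sum.reindex_bij_betw[OF bij, symmetric])
    also have "\<dots> = lookup (polytabloid lam (q \<circ> t)) U"
      unfolding polytabloid_comp[OF column_stabilizerD(1)[OF q]] lookup_sum lookup_single
      by (intro sum.cong refl)
        (use q in \<open>simp add: sign_compose column_stabilizerD(2) mult_when flip: mult.assoc of_int_mult\<close>)
    finally show "lookup (polytabloid lam (q \<circ> t)) U
      = lookup (Poly_Mapping.map ((*) (of_int (sign q))) (polytabloid lam t)) U" by simp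
  qed
qed

lemma tabloid_eq_iff:
  assumes "s \<in> tableaux lam" "t \<in> tableaux lam"
  shows "tabloid lam s = tabloid lam t \<longleftrightarrow> (\<forall>i. s ` diagram_row lam i = t ` diagram_row lam i)"
proof
  assume "tabloid lam s = tabloid lam t"
  moreover have "s \<in> tabloid lam s" using assms(1) by (simp add: tabloid_def)
  ultimately show "\<forall>i. s ` diagram_row lam i = t ` diagram_row lam i" by (simp add: tabloid_def)
qed (simp add: tabloid_def)

lemma tabloid_switch_row:
  assumes t: "t \<in> tableaux lam" and x: "x \<in> diagram_row lam i" and y: "y \<in> diagram_row lam i"
  shows "tabloid lam (switch x y t) = tabloid lam t"
proof -
  have D: "x \<in> diagram lam" "y \<in> diagram lam" using x y by (auto simp: diagram_row_def)
  have "Transposition.transpose x y ` diagram_row lam j = diagram_row lam j" for j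
    using x y by (subst transpose_image_eq) (auto simp: diagram_row_def)
  hence "switch x y t ` diagram_row lam j = t ` diagram_row lam j" for j
    unfolding switch_def image_comp[symmetric] by simp
  thus ?thesis using t D by (simp add: tabloid_eq_iff switch_tableaux)
qed

text \<open>One inclusion is direct; the other is the same inclusion for the inverse of
  \<open>g\<close>.\<close>

lemma tabloid_act_tabloid:
  assumes g: "g permutes {1..sum_list lam}" and t: "t \<in> tableaux lam"
  shows "tabloid_act g (tabloid lam t) = tabloid lam (g \<circ> t)"
proof -
  have sub: "tableau_act h ` tabloid lam s \<subseteq> tabloid lam (h \<circ> s)" if "h permutes {1..sum_list lam}" for h s
  proof
    fix u assume "u \<in> tableau_act h ` tabloid lam s"
    then obtain u' where u': "u = h \<circ> u'" "u' \<in> tableaux lam" "\<And>i. u' ` diagram_row lam i = s ` diagram_row lam i"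
      by (auto simp: tableau_act_def tabloid_def)
    have "u ` diagram_row lam i = (h \<circ> s) ` diagram_row lam i" for i
      unfolding u'(1) image_comp[of h, symmetric] u'(3) ..
    thus "u \<in> tabloid lam (h \<circ> s)"
      using permutes_comp_tableau[OF that u'(2)] u'(1) by (simp add: tabloid_def)
  qed
  have gi: "inv' g \<circ> g = id" "g \<circ> inv' g = id" using permutes_inv_o[OF g] by auto
  have "tabloid lam (g \<circ> t) \<subseteq> tableau_act g ` tabloid lam t"
  proof
    fix s assume "s \<in> tabloid lam (g \<circ> t)"
    hence "inv' g \<circ> s \<in> tabloid lam (inv' g \<circ> (g \<circ> t))"
      using sub[OF permutes_inv[OF g], of "g \<circ> t"] by (auto simp: tableau_act_def)
    moreover have "inv' g \<circ> (g \<circ> t) = t" "s = tableau_act g (inv' g \<circ> s)"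
      using gi by (simp_all add: o_assoc tableau_act_def)
    ultimately show "s \<in> tableau_act g ` tabloid lam t" by auto
  qed
  thus ?thesis using sub[OF g, of t] by (auto simp: tabloid_act_def)
qed

lemma keys_polytabloid:
  assumes "t \<in> tableaux lam"
  shows "keys (polytabloid lam t) \<subseteq> tabloids lam"
proof -
  have "keys (polytabloid lam t) \<subseteq> (\<Union>q\<in>column_stabilizer lam t. {tabloid lam (q \<circ> t)})"
    unfolding polytabloid_def tableau_act_def
    by (rule order_trans[OF keys_sum]) (auto simp: finite_column_stabilizer split: if_splits)
  also have "\<dots> \<subseteq> tabloids lam"
    using assms permutes_comp_tableau column_stabilizerD(1) by (fastforce simp: tabloids_def)
  finally show ?thesis .
qed

lemma free_act_polytabloid:
  assumes g: "g permutes {1..sum_list lam}" and t: "t \<in> tableaux lam"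
  shows "free_act (tabloids lam) tabloid_act g (polytabloid lam t) = polytabloid lam (g \<circ> t)"
proof -
  have "free_act (tabloids lam) tabloid_act g (polytabloid lam t)
    = linear_extension (\<lambda>U. Poly_Mapping.single (tabloid_act g U) 1) (polytabloid lam t)"
    by (rule free_act_eq[OF keys_polytabloid[OF t]])
  also have "\<dots> = (\<Sum>q\<in>column_stabilizer lam t. Poly_Mapping.single (tabloid_act g (tabloid lam (q \<circ> t))) (of_int (sign q)))"
    by (simp add: polytabloid_def linear_extension_sum tableau_act_def)
  also have "\<dots> = polytabloid lam (g \<circ> t)"
    unfolding polytabloid_comp[OF g]
    by (intro sum.cong refl)
      (use t in \<open>simp add: tabloid_act_tabloid[OF g] permutes_comp_tableau[OF column_stabilizerD(1)] o_assoc\<close>)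
  finally show ?thesis .
qed

section \<open>Garnir relations with a single exchanged entry\<close>

lemma self_eq_uminus_iff: "f = - f \<longleftrightarrow> f = (0 :: 'a \<Rightarrow>\<^sub>0 complex)"
proof
  assume f: "f = - f"
  have "lookup f x = - lookup f x" for x
    using arg_cong[OF f, of "\<lambda>f. lookup f x"] by simp
  thus "f = 0" by (intro poly_mapping_eqI) (simp add: complex_eq_iff)
qed simp

text \<open>Expanded over the stabilizer of \<open>t\<close>, the terms on the left are indexed by
  \<open>q\<close> and an entry \<open>b\<close> of column \<open>c'\<close>. If \<open>b\<close>
  stands in \<open>q \<circ> t\<close> in the row of \<open>a = t x\<close>, exchanging the two
  leaves the tabloid unchanged, and these terms add up to the polytabloid of \<open>t\<close>. The
  others cancel in pairs.\<close>

lemma polytabloid_exchange: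
  assumes t: "t \<in> tableaux lam" and x: "x \<in> diagram_column lam c" and c': "1 \<le> c'" "c' < c"
  shows "(\<Sum>y\<in>diagram_column lam c'. polytabloid lam (switch x y t)) = polytabloid lam t"
proof -
  define C where "C = column_stabilizer lam t"
  define B where "B = t ` diagram_column lam c'"
  define a where "a = t x"
  define F where "F q b = Poly_Mapping.single (tabloid lam (Transposition.transpose a b \<circ> q \<circ> t)) (of_int (sign q) :: complex)" for q b
  \<comment> \<open>In \<open>q \<circ> t\<close> the entry \<open>a\<close> stands in
    \<open>cell q\<close>; \<open>cell' q\<close> is the cell of column \<open>c'\<close> in the
    same row, and \<open>b0 q\<close> is the entry there.\<close>
  define cell where "cell q = inv_into (diagram lam) (q \<circ> t) a" for q
  define cell' where "cell' q = (fst (cell q), c')" for q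
  define b0 where "b0 q = q (t (cell' q))" for q
  note xD = column_in_diagram[OF x]
  have finC: "finite C" and finB: "finite B"
    by (simp_all add: C_def B_def finite_column_stabilizer finite_diagram_column)
  have qt: "q \<circ> t \<in> tableaux lam" if "q \<in> C" for q
    using that t unfolding C_def by (intro permutes_comp_tableau column_stabilizerD(1))
  have a_notin: "a \<notin> B"
  proof
    assume "a \<in> B"
    then obtain y where y: "y \<in> diagram_column lam c'" "t y = t x" by (auto simp: a_def B_def)
    hence "y = x" using tableau_entry_eq_iff[OF t xD] by simp
    thus False using y x columns_disjoint c'(2) by blast
  qed
  have cell_eqI: "cell q = z" if "q \<in> C" "z \<in> diagram lam" "q (t z) = a" for q z
    unfolding cell_def using that tableaux_inj[OF qt[OF that(1)]] by (intro inv_into_f_eq) auto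
  have cell: "cell q \<in> diagram_column lam c" "q (t (cell q)) = a" if q: "q \<in> C" for q
  proof -
    have "a \<in> q ` t ` diagram_column lam c"
      using column_stabilizerD(3)[of q lam t c] q x by (auto simp: a_def C_def)
    then obtain z where z: "z \<in> diagram_column lam c" "q (t z) = a" by auto
    hence "cell q = z" using q column_in_diagram by (intro cell_eqI)
    thus "cell q \<in> diagram_column lam c" "q (t (cell q)) = a" using z by auto
  qed
  \<comment> \<open>This is where \<open>c' < c\<close> enters: rows are initial segments, so column
    \<open>c'\<close> meets every row that column \<open>c\<close> meets.\<close>
  have cell': "cell' q \<in> diagram_column lam c'" if q: "q \<in> C" for q
    using cell(1)[OF q] c' by (auto simp: cell'_def diagram_column_def diagram_def)
  have rows: "cell q \<in> diagram_row lam (fst (cell q))" "cell' q \<in> diagram_row lam (fst (cell q))"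
    if q: "q \<in> C" for q
    using cell(1)[OF q] cell'[OF q] by (auto simp: diagram_row_def diagram_column_def cell'_def)
  have b0: "b0 q \<in> B" if q: "q \<in> C" for q
  proof -
    have "b0 q \<in> q ` t ` diagram_column lam c'" using cell'[OF q] by (simp add: b0_def)
    thus ?thesis using column_stabilizerD(3)[of q lam t c'] q by (simp add: B_def C_def)
  qed
  \<comment> \<open>Used with \<open>g\<close> the identity for the terms that survive, and with
    \<open>g\<close> the transposition of \<open>a\<close> and \<open>b\<close> for those that
    cancel.\<close>
  have row_switch: "tabloid lam (Transposition.transpose (g (q (t (cell q)))) (g (q (t (cell' q)))) \<circ> (g \<circ> (q \<circ> t))) = tabloid lam (g \<circ> (q \<circ> t))"
    if q: "q \<in> C" and g: "g permutes {1..sum_list lam}" for q g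
  proof -
    have "tabloid lam (switch (cell q) (cell' q) (g \<circ> (q \<circ> t))) = tabloid lam (g \<circ> (q \<circ> t))"
      using permutes_comp_tableau[OF g qt[OF q]] rows[OF q] by (rule tabloid_switch_row)
    thus ?thesis
      using switch_eq_comp[OF permutes_comp_tableau[OF g qt[OF q]], of "cell q" "cell' q"]
        cell(1)[OF q] cell'[OF q] column_in_diagram by simp
  qed
  have F_b0: "F q (b0 q) = Poly_Mapping.single (tabloid lam (q \<circ> t)) (of_int (sign q))" if q: "q \<in> C" for q
    using row_switch[OF q permutes_id] cell(2)[OF q] by (simp add: F_def b0_def comp_assoc)
  define P where "P = Sigma C (\<lambda>q. B - {b0 q})"
  \<comment> \<open>The sign-reversing involution on the remaining terms: \<open>b\<close> and
    \<open>b0 q\<close> trade places in column \<open>c'\<close>, after which \<open>b\<close> is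
    the entry in the row of \<open>a\<close>.\<close>
  define \<phi> where "\<phi> = (\<lambda>(q, b). (Transposition.transpose b (b0 q) \<circ> q, b0 q))"
  have step: "\<phi> (q, b) \<in> P \<and> \<phi> (\<phi> (q, b)) = (q, b) \<and> case_prod F (\<phi> (q, b)) = - F q b" if "(q, b) \<in> P" for q b
  proof -
    have q: "q \<in> C" and b: "b \<in> B" "b \<noteq> b0 q" using that by (auto simp: P_def)
    let ?\<tau> = "Transposition.transpose b (b0 q)"
    have \<tau>: "?\<tau> \<in> C"
      using transpose_column_stabilizer[OF t, of b c' "b0 q"] b b0[OF q] by (simp add: C_def B_def)
    have q': "?\<tau> \<circ> q \<in> C" using q \<tau> unfolding C_def by (intro comp_column_stabilizer)
    have ab: "a \<noteq> b" "a \<noteq> b0 q" using a_notin b b0[OF q] by auto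
    have "cell (?\<tau> \<circ> q) = cell q"
      using cell[OF q] ab by (intro cell_eqI q' column_in_diagram) (auto simp: Transposition.transpose_def)
    hence b0': "b0 (?\<tau> \<circ> q) = b" by (simp add: b0_def cell'_def)
    have "\<phi> (\<phi> (q, b)) = (q, b)"
      by (simp add: \<phi>_def b0' transpose_commute o_assoc)
    moreover have "\<phi> (q, b) \<in> P" using q' b b0[OF q] by (simp add: \<phi>_def P_def b0')
    moreover have "F (?\<tau> \<circ> q) (b0 q) = - F q b"
    proof -
      have "Transposition.transpose a b permutes {1..sum_list lam}"
        using permutes_transpose_entries[OF t xD] b column_in_diagram by (auto simp: B_def a_def)
      from row_switch[OF q this]
      have "tabloid lam (Transposition.transpose b (b0 q) \<circ> (Transposition.transpose a b \<circ> (q \<circ> t)))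
        = tabloid lam (Transposition.transpose a b \<circ> (q \<circ> t))"
        using cell(2)[OF q] ab b by (simp add: b0_def transpose_apply_other)
      \<comment> \<open>The identity (b b0)(a b) = (a b0)(b b0) compares the two tabloids: on its
        left the outer transposition exchanges two entries of one row of the tableau it is applied
        to.\<close>
      moreover have "Transposition.transpose b (b0 q) \<circ> (Transposition.transpose a b \<circ> (q \<circ> t))
        = Transposition.transpose a (b0 q) \<circ> (?\<tau> \<circ> q) \<circ> t"
        using ab b by (auto simp: fun_eq_iff Transposition.transpose_def)
      ultimately have "tabloid lam (Transposition.transpose a (b0 q) \<circ> (?\<tau> \<circ> q) \<circ> t)
        = tabloid lam (Transposition.transpose a b \<circ> q \<circ> t)" by (simp add: comp_assoc)
      moreover have "sign (?\<tau> \<circ> q) = - sign q"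
        using column_stabilizerD(2) q \<tau> b(2) by (subst sign_compose) (auto simp: C_def sign_swap_id)
      ultimately show ?thesis by (simp add: F_def single_uminus)
    qed
    hence "case_prod F (\<phi> (q, b)) = - F q b" by (simp add: \<phi>_def)
    ultimately show ?thesis by blast
  qed
  have "(\<Sum>p\<in>P. case_prod F p) = (\<Sum>p\<in>P. - case_prod F p)"
    by (rule sum.reindex_bij_witness[of _ \<phi> \<phi>]) (use step in auto)
  hence zero: "(\<Sum>p\<in>P. case_prod F p) = 0"
    by (simp add: sum_negf self_eq_uminus_iff)
  have "(\<Sum>y\<in>diagram_column lam c'. polytabloid lam (switch x y t))
    = (\<Sum>y\<in>diagram_column lam c'. \<Sum>q\<in>C. F q (t y))"
    unfolding F_def C_def a_def
    by (intro sum.cong refl)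
      (simp add: switch_eq_comp[OF t xD column_in_diagram] polytabloid_comp[OF permutes_transpose_entries[OF t xD column_in_diagram]])
  also have "\<dots> = (\<Sum>b\<in>B. \<Sum>q\<in>C. F q b)"
    unfolding B_def using tableaux_inj[OF t] diagram_column_subset
    by (subst sum.reindex) (auto intro: inj_on_subset)
  also have "\<dots> = (\<Sum>q\<in>C. \<Sum>b\<in>B. F q b)" by (rule sum.swap)
  also have "\<dots> = (\<Sum>q\<in>C. F q (b0 q) + (\<Sum>b\<in>B - {b0 q}. F q b))"
    by (intro sum.cong refl sum.remove finB b0)
  also have "\<dots> = (\<Sum>q\<in>C. F q (b0 q)) + (\<Sum>p\<in>P. case_prod F p)"
    unfolding P_def using finC finB by (simp add: sum.distrib sum.Sigma)
  also have "\<dots> = polytabloid lam t"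
    by (simp add: zero F_b0 polytabloid_def C_def tableau_act_def)
  finally show ?thesis .
qed

section \<open>Column-antisymmetric functions on tableaux\<close>

definition column_antisymmetric :: "nat list \<Rightarrow> (tableau \<Rightarrow> complex) \<Rightarrow> bool"
  where "column_antisymmetric lam v \<longleftrightarrow> (\<forall>t\<in>tableaux lam. \<forall>c. \<forall>x\<in>diagram_column lam c.
    \<forall>y\<in>diagram_column lam c. x \<noteq> y \<longrightarrow> v (switch x y t) = - v t)"

text \<open>Antisymmetry is given for a single switch of cells. An element of the stabilizer is
  peeled off into transpositions, by induction on the number of entries that it moves.\<close>

lemma column_antisymmetric_sign:
  assumes v: "column_antisymmetric lam v" and s: "s \<in> tableaux lam"
    and "q \<in> column_stabilizer lam s"
  shows "v (q \<circ> s) = of_int (sign q) * v s"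
  using assms(3)
proof (induction "card {e. q e \<noteq> e}" arbitrary: q rule: less_induct)
  case (less q)
  note q = column_stabilizerD[OF less.prems]
  have fin: "finite {e. q e \<noteq> e}"
    by (rule finite_subset[of _ "{1..sum_list lam}"]) (use permutes_not_in[OF q(1)] in blast)+
  show ?case
  proof (cases "q = id")
    case True
    thus ?thesis by simp
  next
    case False
    then obtain a where a: "q a \<noteq> a" by (auto simp: fun_eq_iff)
    hence "a \<in> {1..sum_list lam}" using permutes_not_in[OF q(1)] by blast
    then obtain x where x: "x \<in> diagram lam" "a = s x"
      using bij_betw_imp_surj_on[OF tableaux_bij[OF s]] by blast
    have xc: "x \<in> diagram_column lam (snd x)" using x by (simp add: diagram_column_def)
    have "q a \<in> s ` diagram_column lam (snd x)" using q(3)[of "snd x"] xc x by blast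
    let ?\<tau> = "Transposition.transpose a (q a)"
    have \<tau>: "?\<tau> \<in> column_stabilizer lam s"
      by (rule transpose_column_stabilizer[OF s _ \<open>q a \<in> _\<close>]) (use xc x in auto)
    define p where "p = ?\<tau> \<circ> q"
    have p: "p \<in> column_stabilizer lam s" unfolding p_def by (intro comp_column_stabilizer \<tau> less.prems)
    have qp: "q = ?\<tau> \<circ> p" by (simp add: p_def o_assoc)
    \<comment> \<open>Composing with the transposition makes \<open>a\<close> fixed and unfixes
      nothing, because a point fixed by \<open>q\<close> is neither \<open>a\<close> nor
      \<open>q a\<close>.\<close>
    have "{e. p e \<noteq> e} \<subset> {e. q e \<noteq> e}"
    proof -
      have "p a = a" by (simp add: p_def)
      moreover have "p e = e" if "q e = e" for e
      proof -
        have "e \<noteq> a" "e \<noteq> q a"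
          using that a permutes_inj[OF q(1)] by (auto simp: inj_def)
        thus ?thesis using that by (simp add: p_def transpose_apply_other)
      qed
      ultimately show ?thesis using a by blast
    qed
    hence "card {e. p e \<noteq> e} < card {e. q e \<noteq> e}" by (rule psubset_card_mono[OF fin])
    from less.hyps[OF this p] have IH: "v (p \<circ> s) = of_int (sign p) * v s" .
    have "a \<in> p ` s ` diagram_column lam (snd x)" "q a \<in> p ` s ` diagram_column lam (snd x)"
      using column_stabilizerD(3)[OF p] \<open>q a \<in> _\<close> x xc by auto
    then obtain y z where yz: "y \<in> diagram_column lam (snd x)" "z \<in> diagram_column lam (snd x)"
      "a = p (s y)" "q a = p (s z)" by auto
    have ps: "p \<circ> s \<in> tableaux lam" using s column_stabilizerD(1)[OF p] by (intro permutes_comp_tableau)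
    \<comment> \<open>Both transposed entries stand in one column of \<open>p \<circ> s\<close>, so
      the transposition of entries is a switch of two cells of that column.\<close>
    have "q \<circ> s = switch y z (p \<circ> s)"
      using switch_eq_comp[OF ps, of y z] yz column_in_diagram by (subst qp) (simp add: comp_assoc)
    moreover have "y \<noteq> z" using yz a by auto
    ultimately have "v (q \<circ> s) = - v (p \<circ> s)"
      using v ps yz(1,2) unfolding column_antisymmetric_def by metis
    moreover have "sign q = - sign p"
      using column_stabilizerD(2)[OF \<tau>] column_stabilizerD(2)[OF p] a by (subst qp) (simp add: sign_compose sign_swap_id)
    ultimately show ?thesis using IH by simp
  qed
qed

section \<open>The operator exchanging one cell with a whole column\<close>

text \<open>The operator \<open>H\<close> of the overview, for the cell \<open>x\<close> and the
  column \<open>c\<close>.\<close>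

definition exchange_sum :: "nat list \<Rightarrow> nat \<Rightarrow> nat \<times> nat \<Rightarrow> (tableau \<Rightarrow> 'a::comm_monoid_add) \<Rightarrow> tableau \<Rightarrow> 'a"
  where "exchange_sum lam c x v t = (\<Sum>y\<in>diagram_column lam c. v (switch x y t))"

lemma sum_switch_swap:
  fixes f g :: "tableau \<Rightarrow> 'a::comm_semiring_0"
  assumes "x \<in> diagram lam" "y \<in> diagram lam"
  shows "(\<Sum>t\<in>tableaux lam. f (switch x y t) * g t) = (\<Sum>t\<in>tableaux lam. f t * g (switch x y t))"
  by (rule sum.reindex_bij_witness[of _ "switch x y" "switch x y"])
    (use assms in \<open>auto simp: switch_tableaux\<close>)

text \<open>Each \<open>switch x y\<close> is an involution on the tableaux, hence self-adjoint for
  the Hermitian pairing, and so is a sum of such switches.\<close>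

lemma exchange_sum_adjoint:
  assumes x: "x \<in> diagram lam"
  shows "(\<Sum>t\<in>tableaux lam. exchange_sum lam c x f t * cnj (g t))
    = (\<Sum>t\<in>tableaux lam. f t * cnj (exchange_sum lam c x g t))"
proof -
  have "(\<Sum>t\<in>tableaux lam. exchange_sum lam c x f t * cnj (g t))
    = (\<Sum>y\<in>diagram_column lam c. \<Sum>t\<in>tableaux lam. f (switch x y t) * cnj (g t))"
    unfolding exchange_sum_def sum_distrib_right by (rule sum.swap)
  also have "\<dots> = (\<Sum>y\<in>diagram_column lam c. \<Sum>t\<in>tableaux lam. f t * cnj (g (switch x y t)))"
    by (intro sum.cong refl sum_switch_swap x column_in_diagram)
  also have "\<dots> = (\<Sum>t\<in>tableaux lam. f t * cnj (exchange_sum lam c x g t))"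
    unfolding exchange_sum_def cnj_sum sum_distrib_left by (rule sum.swap)
  finally show ?thesis .
qed

lemma exchange_sum_diff:
  fixes f g :: "tableau \<Rightarrow> 'a::ab_group_add"
  shows "exchange_sum lam c x (\<lambda>t. f t - g t) t = exchange_sum lam c x f t - exchange_sum lam c x g t"
  by (simp add: exchange_sum_def sum_subtractf)

text \<open>Since \<open>1 - exchange_sum\<close> is a multiple of the antisymmetrizer of column \<open>c'\<close> enlarged by the cell \<open>x\<close>,
  it is a multiple of a projection.\<close>

lemma exchange_sum_exchange_sum:
  assumes v: "column_antisymmetric lam v" and t: "t \<in> tableaux lam"
    and x: "x \<in> diagram_column lam c" and c: "c' \<noteq> c"
  shows "exchange_sum lam c' x (exchange_sum lam c' x v) t
    = of_nat (card (diagram_column lam c')) * v t - (of_nat (card (diagram_column lam c')) - 1) * exchange_sum lam c' x v t"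
proof -
  let ?C = "diagram_column lam c'"
  \<comment> \<open>Two equal switches cancel. For \<open>y \<noteq> y'\<close> the product of two
    transpositions sharing \<open>x\<close> can be rewritten with one factor inside column
    \<open>c'\<close>, and antisymmetry turns that factor into a sign.\<close>
  have v': "v (switch x y (switch x y' t)) = (if y = y' then v t else - v (switch x y t))"
    if y: "y \<in> ?C" "y' \<in> ?C" for y y'
  proof (cases "y = y'")
    case False
    have "x \<noteq> y" "x \<noteq> y'" using x y c columns_disjoint by blast+
    hence "switch x y (switch x y' t) = switch y y' (switch x y t)"
      using False by (auto simp: fun_eq_iff switch_def Transposition.transpose_def)
    moreover have "switch x y t \<in> tableaux lam" using t x y column_in_diagram by (intro switch_tableaux)
    ultimately show ?thesis using v y False unfolding column_antisymmetric_def by metis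
  qed simp
  have "exchange_sum lam c' x (exchange_sum lam c' x v) t
    = (\<Sum>y'\<in>?C. \<Sum>y\<in>?C. if y = y' then v t else - v (switch x y t))"
    unfolding exchange_sum_def by (intro sum.cong refl v')
  also have "\<dots> = (\<Sum>y'\<in>?C. v t - (exchange_sum lam c' x v t - v (switch x y' t)))"
  proof (intro sum.cong refl)
    fix y' assume y': "y' \<in> ?C"
    have "(\<Sum>y\<in>?C. if y = y' then v t else - v (switch x y t))
      = v t + (\<Sum>y\<in>?C - {y'}. - v (switch x y t))"
      using y' finite_diagram_column by (subst sum.remove[of _ y']) (auto intro!: sum.cong)
    moreover have "exchange_sum lam c' x v t = v (switch x y' t) + (\<Sum>y\<in>?C - {y'}. v (switch x y t))"
      unfolding exchange_sum_def using y' finite_diagram_column by (intro sum.remove)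
    ultimately show "(\<Sum>y\<in>?C. if y = y' then v t else - v (switch x y t))
      = v t - (exchange_sum lam c' x v t - v (switch x y' t))"
      by (simp add: sum_negf)
  qed
  also have "\<dots> = of_nat (card ?C) * v t - (of_nat (card ?C) - 1) * exchange_sum lam c' x v t"
    by (simp add: sum_subtractf sum.distrib algebra_simps exchange_sum_def)
  finally show ?thesis .
qed

text \<open>With \<open>H\<close> the exchange sum and \<open>a\<close> the length of column
  \<open>c'\<close>, the quadratic identity above reads (H - 1)(H + a) = 0. So \<open>u\<close> is
  an eigenvector of \<open>H\<close> for -a, and moving \<open>H\<close> across the pairing of
  \<open>u\<close> with \<open>H v\<close> produces the factor 1 + a.\<close>

lemma exchange_defect_norm:
  assumes v: "column_antisymmetric lam v" and x: "x \<in> diagram_column lam c" and c: "c' \<noteq> c"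
  defines "u \<equiv> \<lambda>t. v t - exchange_sum lam c' x v t"
  shows "(\<Sum>t\<in>tableaux lam. u t * cnj (u t))
    = (1 + of_nat (card (diagram_column lam c'))) * (\<Sum>t\<in>tableaux lam. u t * cnj (v t))"
proof -
  let ?a = "of_nat (card (diagram_column lam c')) :: complex"
  have Hu: "exchange_sum lam c' x u t = - ?a * u t" if "t \<in> tableaux lam" for t
    unfolding u_def exchange_sum_diff exchange_sum_exchange_sum[OF v that x c]
    by (simp add: algebra_simps)
  have "(\<Sum>t\<in>tableaux lam. u t * cnj (u t))
    = (\<Sum>t\<in>tableaux lam. u t * cnj (v t)) - (\<Sum>t\<in>tableaux lam. u t * cnj (exchange_sum lam c' x v t))"
    unfolding sum_subtractf[symmetric] by (intro sum.cong refl) (simp add: u_def algebra_simps)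
  also have "(\<Sum>t\<in>tableaux lam. u t * cnj (exchange_sum lam c' x v t))
    = (\<Sum>t\<in>tableaux lam. exchange_sum lam c' x u t * cnj (v t))"
    by (rule exchange_sum_adjoint[symmetric]) (rule column_in_diagram[OF x])
  also have "\<dots> = - ?a * (\<Sum>t\<in>tableaux lam. u t * cnj (v t))"
    unfolding sum_distrib_left by (intro sum.cong refl) (simp add: Hu)
  finally show ?thesis by (simp add: algebra_simps)
qed

text \<open>\<open>left_switches\<close> is a set, so different choices must give different
  tableaux. They do: \<open>x\<close> is the only cell of column \<open>c\<close> whose entry
  changes, and its new entry determines \<open>y\<close>.\<close>

lemma left_switches_sum:
  assumes t: "t \<in> tableaux lam"
  shows "(\<Sum>s\<in>left_switches lam c t. f s)
    = (\<Sum>c'\<in>{1..<c}. \<Sum>x\<in>diagram_column lam c. \<Sum>y\<in>diagram_column lam c'. f (switch x y t))"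
proof -
  define P where "P = (SIGMA c':{1..<c}. SIGMA x:diagram_column lam c. diagram_column lam c')"
  define h where "h = (\<lambda>(c'::nat, x, y). switch x y t)"
  have eq: "left_switches lam c t = h ` P"
  proof (intro equalityI subsetI)
    fix s assume "s \<in> left_switches lam c t"
    then obtain x y c' where s: "s = switch x y t" "c' < c" "x \<in> diagram_column lam c" "y \<in> diagram_column lam c'"
      by (auto simp: left_switches_def)
    \<comment> \<open>Columns are numbered from 1, so the index 0 allowed by \<open>c' < c\<close>
      contributes no cell.\<close>
    moreover have "1 \<le> c'" using s(4) by (auto simp: diagram_column_def diagram_def)
    ultimately show "s \<in> h ` P" by (force simp: h_def P_def)
  next
    fix s assume "s \<in> h ` P"
    then obtain c' x y where "s = switch x y t" "c' < c" "x \<in> diagram_column lam c" "y \<in> diagram_column lam c'"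
      unfolding h_def P_def by auto
    thus "s \<in> left_switches lam c t" unfolding left_switches_def by blast
  qed
  have "inj_on h P"
  proof (rule inj_onI)
    fix p p' assume p: "p \<in> P" "p' \<in> P" and h: "h p = h p'"
    obtain d x y d' x' y' where pp: "p = (d, x, y)" "p' = (d', x', y')" by (metis prod_cases3)
    have m: "d < c" "d' < c" "x \<in> diagram_column lam c" "x' \<in> diagram_column lam c"
      "y \<in> diagram_column lam d" "y' \<in> diagram_column lam d'"
      using p by (auto simp: P_def pp)
    have xy: "snd x = c" "snd x' = c" "snd y = d" "snd y' = d'" using m by (auto simp: diagram_column_def)
    \<comment> \<open>Evaluating at the cell \<open>x'\<close> of column \<open>c\<close> is enough:
      neither \<open>y\<close> nor \<open>y'\<close> lies in that column.\<close>
    have "switch x y t x' = switch x' y' t x'" using h by (simp add: h_def pp)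
    hence "t (Transposition.transpose x y x') = t y'" by (simp add: switch_def)
    hence "Transposition.transpose x y x' = y'"
      using tableau_entry_eq_iff[OF t column_in_diagram[OF m(6)]] by simp
    moreover have "x' \<noteq> y" "x' \<noteq> y'" using xy m by auto
    ultimately have "x' = x" "y' = y" by (auto simp: Transposition.transpose_def split: if_splits)
    thus "p = p'" using xy by (simp add: pp)
  qed
  hence "(\<Sum>s\<in>left_switches lam c t. f s) = (\<Sum>p\<in>P. f (h p))"
    unfolding eq by (simp add: sum.reindex)
  also have "\<dots> = (\<Sum>c'\<in>{1..<c}. \<Sum>x\<in>diagram_column lam c. \<Sum>y\<in>diagram_column lam c'. f (switch x y t))"
    unfolding P_def by (simp add: sum.Sigma finite_diagram_column finite_SigmaI h_def case_prod_unfold)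
  finally show ?thesis .
qed

text \<open>The Garnir relations with a single exchanged entry, as conditions on a function: one for
  each cell and each column to its left, without averaging.\<close>

definition exchange_invariant :: "nat list \<Rightarrow> (tableau \<Rightarrow> complex) \<Rightarrow> bool"
  where "exchange_invariant lam v \<longleftrightarrow> (\<forall>t\<in>tableaux lam. \<forall>c c'. \<forall>x\<in>diagram_column lam c.
    1 \<le> c' \<longrightarrow> c' < c \<longrightarrow> exchange_sum lam c' x v t = v t)"

text \<open>The averaged relations imply the individual ones, by positivity: pairing the relation with \<open>v\<close>
  gives a vanishing sum of positive multiples of squared norms.\<close>

lemma exchange_invariantI:
  assumes v: "column_antisymmetric lam v"
    and rel: "\<And>t c. t \<in> tableaux lam \<Longrightarrow> 2 \<le> c \<Longrightarrow> diagram_column lam c \<noteq> {} \<Longrightarrow>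
      of_nat ((c - 1) * card (diagram_column lam c)) * v t = (\<Sum>s\<in>left_switches lam c t. v s)"
  shows "exchange_invariant lam v"
  unfolding exchange_invariant_def
proof (intro ballI allI impI)
  fix t c c' x assume t: "t \<in> tableaux lam" and x: "x \<in> diagram_column lam c" and c': "1 \<le> c'" "c' < c"
  define u where "u = (\<lambda>d x t. v t - exchange_sum lam d x v t)"
  define nrm where "nrm = (\<lambda>d x. \<Sum>t\<in>tableaux lam. (cmod (u d x t))\<^sup>2)"
  \<comment> \<open>The inverse of the factor from \<open>exchange_defect_norm\<close>. It varies
    with the column \<open>d\<close> and therefore stays inside the sum, where only its positivity
    matters.\<close>
  define w where "w = (\<lambda>d. inverse (1 + real (card (diagram_column lam d))))"
  have nrm: "complex_of_real (w d * nrm d x) = (\<Sum>t\<in>tableaux lam. u d x t * cnj (v t))"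
    if "d \<in> {1..<c}" "x \<in> diagram_column lam c" for d x
  proof -
    let ?S = "\<Sum>t\<in>tableaux lam. u d x t * cnj (v t)"
    let ?a = "1 + complex_of_nat (card (diagram_column lam d))"
    have a: "?a \<noteq> 0" using of_nat_neq_0[of "card (diagram_column lam d)", where 'a = complex] by simp
    have "complex_of_real (nrm d x) = (\<Sum>t\<in>tableaux lam. u d x t * cnj (u d x t))"
      unfolding nrm_def of_real_sum complex_norm_square ..
    also have "\<dots> = ?a * ?S"
      unfolding u_def by (rule exchange_defect_norm[OF v that(2)]) (use that in simp)
    finally have "complex_of_real (nrm d x) = ?a * ?S" .
    moreover have "complex_of_real (w d) = inverse ?a" by (simp add: w_def)
    ultimately show ?thesis using a by simp
  qed
  have "complex_of_real (\<Sum>d\<in>{1..<c}. \<Sum>x\<in>diagram_column lam c. w d * nrm d x)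
    = (\<Sum>d\<in>{1..<c}. \<Sum>x\<in>diagram_column lam c. \<Sum>t\<in>tableaux lam. u d x t * cnj (v t))"
    unfolding of_real_sum by (intro sum.cong refl nrm)
  also have "\<dots> = (\<Sum>t\<in>tableaux lam. \<Sum>d\<in>{1..<c}. \<Sum>x\<in>diagram_column lam c. u d x t * cnj (v t))"
    by (subst sum.swap[of _ "tableaux lam"]) (intro sum.cong refl sum.swap)
  \<comment> \<open>The term \<open>v t\<close> occurs once for each of the \<open>c - 1\<close>
    columns and each cell of column \<open>c\<close>, which is exactly the coefficient in the
    relation.\<close>
  also have "\<dots> = (\<Sum>t\<in>tableaux lam. (of_nat ((c - 1) * card (diagram_column lam c)) * v t
    - (\<Sum>s\<in>left_switches lam c t. v s)) * cnj (v t))"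
    by (intro sum.cong refl)
      (simp add: left_switches_sum u_def exchange_sum_def sum_subtractf mult.assoc
        flip: sum_distrib_right)
  also have "\<dots> = 0"
    using rel[of _ c] x c' by (intro sum.neutral) auto
  finally have "(\<Sum>d\<in>{1..<c}. \<Sum>x\<in>diagram_column lam c. w d * nrm d x) = 0"
    by (simp only: of_real_eq_0_iff)
  moreover have nonneg: "0 \<le> w d * nrm d x" for d x by (simp add: w_def nrm_def sum_nonneg)
  ultimately have "\<forall>d\<in>{1..<c}. (\<Sum>x\<in>diagram_column lam c. w d * nrm d x) = 0"
    by (subst (asm) sum_nonneg_eq_0_iff) (auto intro: sum_nonneg)
  hence "(\<Sum>x\<in>diagram_column lam c. w c' * nrm c' x) = 0" using c' by simp
  hence "w c' * nrm c' x = 0"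
    using x nonneg finite_diagram_column by (auto simp: sum_nonneg_eq_0_iff)
  moreover have "w c' \<noteq> 0" by (simp add: w_def add_eq_0_iff)
  ultimately have "nrm c' x = 0" by simp
  hence "u c' x t = 0"
    using t finite_tableaux by (simp add: nrm_def sum_nonneg_eq_0_iff)
  thus "exchange_sum lam c' x v t = v t" by (simp add: u_def)
qed

section \<open>Functions determined by their value at one tableau\<close>

lemma obtain_column_stabilizer:
  assumes s: "s \<in> tableaux lam" and t: "t \<in> tableaux lam"
    and eq: "\<And>c. t ` diagram_column lam c = s ` diagram_column lam c"
  obtains q where "q \<in> column_stabilizer lam s" "t = q \<circ> s"
proof
  \<comment> \<open>\<open>q\<close> carries the entries of \<open>s\<close> to those of
    \<open>t\<close> cell by cell. It is the identity elsewhere, as \<open>permutes\<close>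
    requires, and so fixes the dummy value 0.\<close>
  define q where "q e = (if e \<in> {1..sum_list lam} then t (inv_into (diagram lam) s e) else e)" for e
  have qs: "t = q \<circ> s"
  proof
    fix z
    show "t z = (q \<circ> s) z"
    proof (cases "z \<in> diagram lam")
      case True
      thus ?thesis using tableaux_inj[OF s] tableaux_entry[OF s True] by (simp add: q_def)
    next
      case False
      thus ?thesis using s t by (cases z) (simp add: tableaux_def q_def)
    qed
  qed
  have "bij_betw q {1..sum_list lam} {1..sum_list lam}"
  proof -
    have "bij_betw (t \<circ> inv_into (diagram lam) s) {1..sum_list lam} {1..sum_list lam}"
      by (rule bij_betw_trans[OF bij_betw_inv_into[OF tableaux_bij[OF s]] tableaux_bij[OF t]])
    thus ?thesis by (subst bij_betw_cong[where g = "t \<circ> inv_into (diagram lam) s"]) (simp_all add: q_def)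
  qed
  hence "q permutes {1..sum_list lam}"
    by (rule bij_imp_permutes) (simp only: q_def if_False)
  moreover have "q ` s ` diagram_column lam c = s ` diagram_column lam c" for c
    using eq[of c] unfolding qs image_comp[symmetric] .
  ultimately show "q \<in> column_stabilizer lam s" by (simp add: column_stabilizer_iff)
  show "t = q \<circ> s" by (rule qs)
qed

text \<open>Moving an entry into its column of \<open>s\<close> by an exchange relation cancels or decreases the number of
  misplaced entries, so the value at \<open>s\<close> determines all others.\<close>

lemma exchange_invariant_unique:
  assumes f: "exchange_invariant lam f" and s: "s \<in> tableaux lam"
    and sgn: "\<And>q t. q \<in> column_stabilizer lam s \<Longrightarrow> t \<in> tableaux lam \<Longrightarrow> f (q \<circ> t) = of_int (sign q) * f t"
    and zero: "f s = 0" and "t \<in> tableaux lam"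
  shows "f t = 0"
  using assms(5)
proof (induction "card {z \<in> diagram lam. t z \<notin> s ` diagram_column lam (snd z)}" arbitrary: t rule: less_induct)
  case (less t)
  note t = less.prems
  show ?case
  proof (cases "\<forall>c. t ` diagram_column lam c = s ` diagram_column lam c")
    case True
    then obtain q where "q \<in> column_stabilizer lam s" "t = q \<circ> s"
      using obtain_column_stabilizer[OF s t] by blast
    thus ?thesis using sgn s zero by simp
  next
    case False
    \<comment> \<open>The leftmost column whose entries differ from those in \<open>s\<close>. An
      entry of \<open>s\<close> missing there cannot stand further left, where both tableaux agree,
      so it stands further right and can be moved to column \<open>c\<close> by an exchange
      relation.\<close>
    define c where "c = (LEAST c. t ` diagram_column lam c \<noteq> s ` diagram_column lam c)"
    have c: "t ` diagram_column lam c \<noteq> s ` diagram_column lam c"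
      unfolding c_def by (rule LeastI_ex) (use False in blast)
    have below: "t ` diagram_column lam d = s ` diagram_column lam d" if "d < c" for d
      using not_less_Least[of d] that unfolding c_def by blast
    have inj: "inj_on u (diagram_column lam d)" if "u \<in> tableaux lam" for u d
      by (rule inj_on_subset[OF tableaux_inj[OF that] diagram_column_subset])
    have "\<not> s ` diagram_column lam c \<subseteq> t ` diagram_column lam c"
    proof
      assume "s ` diagram_column lam c \<subseteq> t ` diagram_column lam c"
      moreover have "card (s ` diagram_column lam c) = card (t ` diagram_column lam c)"
        by (simp add: card_image inj s t)
      ultimately have "s ` diagram_column lam c = t ` diagram_column lam c"
        by (intro card_subset_eq finite_imageI finite_diagram_column)
      thus False using c by simp
    qed
    then obtain x0 where x0: "x0 \<in> diagram_column lam c" "s x0 \<notin> t ` diagram_column lam c" by blast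
    have "s x0 \<in> {1..sum_list lam}" using x0(1) tableaux_entry[OF s] column_in_diagram by blast
    then obtain x where x: "x \<in> diagram lam" "s x0 = t x"
      using bij_betw_imp_surj_on[OF tableaux_bij[OF t]] by blast
    have xc: "x \<in> diagram_column lam (snd x)" using x by (simp add: diagram_column_def)
    have only: "d = c" if e: "s x0 \<in> s ` diagram_column lam d" for d
    proof -
      obtain z where z: "z \<in> diagram_column lam d" "s x0 = s z" using e by auto
      hence "x0 = z" using tableau_entry_eq_iff[OF s] column_in_diagram by blast
      thus ?thesis using z x0 columns_disjoint by blast
    qed
    have "snd x \<noteq> c" using x x0 xc by auto
    moreover have "\<not> snd x < c" using below[of "snd x"] only[of "snd x"] x xc by auto
    ultimately have lt: "c < snd x" by simp
    have "1 \<le> c" using x0(1) by (auto simp: diagram_column_def diagram_def)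
    hence ex: "exchange_sum lam c x f t = f t"
      using f t xc lt unfolding exchange_invariant_def by blast
    \<comment> \<open>The cells of column \<open>c\<close> whose entry already belongs to that
      column of \<open>s\<close>. Switching with such a cell is a transposition in the stabilizer of
      \<open>s\<close> and yields \<open>- f t\<close>; the other switches vanish by induction,
      which leaves \<open>f t = - of_nat (card Y) * f t\<close>.\<close>
    define Y where "Y = {y \<in> diagram_column lam c. t y \<in> s ` diagram_column lam c}"
    have Y: "f (switch x y t) = - f t" if "y \<in> Y" for y
    proof -
      have y: "y \<in> diagram_column lam c" "t y \<in> s ` diagram_column lam c" using that by (auto simp: Y_def)
      have "Transposition.transpose (t x) (t y) \<in> column_stabilizer lam s"
        using y x x0 by (intro transpose_column_stabilizer[OF s, of _ c]) (auto simp flip: x(2))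
      moreover have "t x \<noteq> t y"
        using y lt tableau_entry_eq_iff[OF t column_in_diagram[OF y(1)]] by (auto simp: diagram_column_def)
      ultimately show ?thesis
        using sgn[OF _ t] switch_eq_comp[OF t x(1) column_in_diagram[OF y(1)]] by (simp add: sign_swap_id)
    qed
    have nY: "f (switch x y t) = 0" if y: "y \<in> diagram_column lam c - Y" for y
    proof (rule less.hyps)
      have yc: "y \<in> diagram_column lam c" "t y \<notin> s ` diagram_column lam c" using y by (auto simp: Y_def)
      have yD: "y \<in> diagram lam" and sy: "snd y = c" using yc by (auto simp: diagram_column_def)
      show "switch x y t \<in> tableaux lam" using t x(1) yD by (rule switch_tableaux)
      \<comment> \<open>The switch puts the right kind of entry into \<open>y\<close>, and
        \<open>x\<close> was misplaced already, so no misplaced cell is created.\<close>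
      have "{z \<in> diagram lam. switch x y t z \<notin> s ` diagram_column lam (snd z)}
        \<subset> {z \<in> diagram lam. t z \<notin> s ` diagram_column lam (snd z)}" (is "?A \<subset> ?B")
      proof
        have "x \<in> ?B" using x(1) only[of "snd x"] lt by (auto simp flip: x(2))
        moreover have "y \<notin> ?A" using x0(1) sy by (auto simp: switch_def simp flip: x(2))
        moreover have "switch x y t z = t z" if "z \<noteq> x" "z \<noteq> y" for z
          using that by (simp add: switch_def)
        ultimately show "?A \<subseteq> ?B" by (metis (mono_tags, lifting) mem_Collect_eq subsetI)
        have "y \<in> ?B" using yD yc sy by simp
        thus "?A \<noteq> ?B" using \<open>y \<notin> ?A\<close> by blast
      qed
      thus "card ?A < card ?B" by (rule psubset_card_mono[rotated]) (simp add: finite_diagram)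
    qed
    have "f t = (\<Sum>y\<in>Y. f (switch x y t)) + (\<Sum>y\<in>diagram_column lam c - Y. f (switch x y t))"
      unfolding ex[symmetric] exchange_sum_def
      by (subst sum.subset_diff[of Y]) (auto simp: Y_def finite_diagram_column)
    also have "\<dots> = - of_nat (card Y) * f t" by (simp add: Y nY)
    finally have "(1 + of_nat (card Y)) * f t = 0"
      by (simp add: ring_distribs eq_neg_iff_add_eq_0)
    moreover have "1 + of_nat (card Y) \<noteq> (0 :: complex)"
      using of_nat_neq_0[of "card Y", where 'a = complex] by simp
    ultimately show "f t = 0" by simp
  qed
qed

section \<open>Alternation over a column stabilizer, and the kernel of the map to
  polytabloids\<close>

definition alternate :: "nat list \<Rightarrow> tableau \<Rightarrow> (tableau \<Rightarrow> complex) \<Rightarrow> tableau \<Rightarrow> complex"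
  where "alternate lam s f t = (\<Sum>q\<in>column_stabilizer lam s. of_int (sign q) * f (q \<circ> t))"

text \<open>Alternation permutes entries and the exchange relations permute cells, so the two
  operations commute.\<close>

lemma exchange_invariant_alternate:
  assumes "exchange_invariant lam f"
  shows "exchange_invariant lam (alternate lam s f)"
  unfolding exchange_invariant_def
proof (intro ballI allI impI)
  fix t c c' x assume *: "t \<in> tableaux lam" "x \<in> diagram_column lam c" "1 \<le> c'" "c' < c"
  have "exchange_sum lam c' x (alternate lam s f) t
    = (\<Sum>q\<in>column_stabilizer lam s. of_int (sign q) * exchange_sum lam c' x f (q \<circ> t))"
    unfolding exchange_sum_def alternate_def sum_distrib_left
    by (subst sum.swap) (simp add: switch_def comp_assoc)
  also have "\<dots> = alternate lam s f t"
    unfolding alternate_def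
  proof (intro sum.cong refl)
    fix q assume "q \<in> column_stabilizer lam s"
    hence "q \<circ> t \<in> tableaux lam" using * column_stabilizerD(1) by (intro permutes_comp_tableau)
    thus "of_int (sign q) * exchange_sum lam c' x f (q \<circ> t) = of_int (sign q) * f (q \<circ> t)"
      using assms * unfolding exchange_invariant_def by metis
  qed
  finally show "exchange_sum lam c' x (alternate lam s f) t = alternate lam s f t" .
qed

text \<open>Right multiplication by \<open>p\<close> permutes the stabilizer. This provides the
  hypothesis \<open>sgn\<close> of \<open>exchange_invariant_unique\<close>.\<close>

lemma alternate_comp:
  assumes p: "p \<in> column_stabilizer lam s"
  shows "alternate lam s f (p \<circ> t) = of_int (sign p) * alternate lam s f t"
proof -
  have bij: "bij_betw (\<lambda>q. q \<circ> p) (column_stabilizer lam s) (column_stabilizer lam s)"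
    by (rule bij_betw_byWitness[where f' = "\<lambda>q. q \<circ> inv' p"])
      (use p in \<open>auto simp: comp_column_stabilizer inv_column_stabilizer comp_assoc
        permutes_inv_o[OF column_stabilizerD(1)[OF p]]\<close>)
  have "alternate lam s f t = (\<Sum>q\<in>column_stabilizer lam s. of_int (sign (q \<circ> p)) * f (q \<circ> p \<circ> t))"
    unfolding alternate_def by (rule sum.reindex_bij_betw[OF bij, symmetric])
  also have "\<dots> = of_int (sign p) * alternate lam s f (p \<circ> t)"
    unfolding alternate_def sum_distrib_left
    by (intro sum.cong refl) (simp add: sign_compose column_stabilizerD(2) p column_stabilizerD(2)[OF p] comp_assoc)
  finally show ?thesis by (simp flip: mult.assoc of_int_mult)
qed

lemma alternate_diff:
  "alternate lam s (\<lambda>t. a * f t - b * g t) t = a * alternate lam s f t - b * alternate lam s g t"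
  by (simp add: alternate_def sum_subtractf sum_distrib_left algebra_simps)

text \<open>At \<open>s\<close> itself, permuting entries within the columns amounts to permuting
  cells within the columns, so antisymmetry makes every term equal to \<open>f s\<close>.\<close>

lemma alternate_self:
  assumes "column_antisymmetric lam f" "s \<in> tableaux lam"
  shows "alternate lam s f s = of_nat (card (column_stabilizer lam s)) * f s"
  by (simp add: alternate_def column_antisymmetric_sign[OF assms] flip: mult.assoc of_int_mult)

text \<open>For fixed \<open>U\<close> this function is a row of the matrix of the map from tableaux
  to polytabloids. Elements of the kernel of that map therefore pair to zero with it.\<close>

lemma column_antisymmetric_lookup_polytabloid:
  "column_antisymmetric lam (\<lambda>t. lookup (polytabloid lam t) U)"
  unfolding column_antisymmetric_def
proof (intro ballI allI impI)
  fix t c x y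
  assume *: "t \<in> tableaux lam" "x \<in> diagram_column lam c" "y \<in> diagram_column lam c" "x \<noteq> y"
  have D: "x \<in> diagram lam" "y \<in> diagram lam" using * column_in_diagram by auto
  have \<tau>: "Transposition.transpose (t x) (t y) \<in> column_stabilizer lam t"
    using * by (intro transpose_column_stabilizer) auto
  have "t x \<noteq> t y" using * D tableau_entry_eq_iff by metis
  thus "lookup (polytabloid lam (switch x y t)) U = - lookup (polytabloid lam t) U"
    unfolding switch_eq_comp[OF *(1) D] polytabloid_column[OF \<tau>] by (simp add: sign_swap_id)
qed

lemma exchange_invariant_lookup_polytabloid:
  "exchange_invariant lam (\<lambda>t. lookup (polytabloid lam t) U)"
  unfolding exchange_invariant_def exchange_sum_def
  by (auto simp: polytabloid_exchange simp flip: lookup_sum)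

text \<open>A row and a column meet in at most one cell, so a permutation of entries preserving all
  rows and all columns of \<open>s\<close> is the identity; only this term contributes.\<close>

lemma lookup_polytabloid_self:
  assumes s: "s \<in> tableaux lam"
  shows "lookup (polytabloid lam s) (tabloid lam s) = 1"
proof -
  have "q = id" if q: "q \<in> column_stabilizer lam s" and tab: "tabloid lam (q \<circ> s) = tabloid lam s" for q
  proof
    fix e
    have qs: "q \<circ> s \<in> tableaux lam" using s column_stabilizerD(1)[OF q] by (intro permutes_comp_tableau)
    show "q e = id e"
    proof (cases "e \<in> {1..sum_list lam}")
      case True
      then obtain x where x: "x \<in> diagram lam" "e = s x"
        using bij_betw_imp_surj_on[OF tableaux_bij[OF s]] by blast
      have "x \<in> diagram_column lam (snd x)" "x \<in> diagram_row lam (fst x)"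
        using x by (auto simp: diagram_column_def diagram_row_def)
      hence "q e \<in> s ` diagram_column lam (snd x)" "q e \<in> s ` diagram_row lam (fst x)"
        using column_stabilizerD(3)[OF q, of "snd x"] tab x(2)
        unfolding tabloid_eq_iff[OF qs s] by (blast, metis comp_apply imageI)
      then obtain y z where yz: "y \<in> diagram_column lam (snd x)" "z \<in> diagram_row lam (fst x)" "q e = s y" "s y = s z"
        by (elim imageE) metis
      have "y = z"
        using tableau_entry_eq_iff[OF s, of z y] yz by (auto simp: diagram_row_def)
      hence "y = x" using yz(1,2) by (simp add: diagram_column_def diagram_row_def prod_eq_iff)
      thus ?thesis using x yz(3) by simp
    qed (use permutes_not_in[OF column_stabilizerD(1)[OF q]] in auto)
  qed
  hence "lookup (polytabloid lam s) (tabloid lam s)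
    = (\<Sum>q\<in>column_stabilizer lam s. if q = id then 1 else 0)"
    unfolding polytabloid_def tableau_act_def lookup_sum lookup_single
    by (intro sum.cong refl) (auto simp: when_def)
  thus ?thesis by (simp add: finite_column_stabilizer id_column_stabilizer)
qed

text \<open>For fixed \<open>s\<close>, alternating \<open>lookup f\<close> and the coefficients
  \<open>w\<close> of polytabloids gives two functions to which
  \<open>exchange_invariant_unique\<close> applies, hence proportional ones:
  \<open>u s * v t = v s * u t\<close>. Since \<open>f\<close> lies in the kernel, \<open>u\<close>
  is orthogonal to \<open>v\<close>, so \<open>v s\<close> times the squared norm of
  \<open>u\<close> is zero.\<close>

lemma exchange_invariant_kernel_trivial:
  assumes f: "keys f \<subseteq> tableaux lam" "linear_extension (polytabloid lam) f = 0"
    and anti: "column_antisymmetric lam (lookup f)" and exch: "exchange_invariant lam (lookup f)"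
  shows "f = 0"
proof -
  have "lookup f s = 0" if s: "s \<in> tableaux lam" for s
  proof -
    define C where "C = column_stabilizer lam s"
    define w where "w t = lookup (polytabloid lam t) (tabloid lam s)" for t
    define u where "u = alternate lam s w"
    define v where "v = alternate lam s (lookup f)"
    have C: "finite C" "C \<noteq> {}"
      unfolding C_def using finite_column_stabilizer id_column_stabilizer by (blast, blast)
    have w_anti: "column_antisymmetric lam w" and w_exch: "exchange_invariant lam w"
      unfolding w_def by (rule column_antisymmetric_lookup_polytabloid exchange_invariant_lookup_polytabloid)+
    have us: "u s = of_nat (card C)" and vs: "v s = of_nat (card C) * lookup f s"
      using s anti w_anti lookup_polytabloid_self[OF s] by (simp_all add: u_def v_def alternate_self C_def w_def)
    \<comment> \<open>The values of \<open>u\<close> are integers, so the bilinear sums below are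
      Hermitian pairings with \<open>u\<close>.\<close>
    have u_real: "cnj (u t) = u t" for t
      by (simp add: u_def alternate_def w_def polytabloid_def lookup_sum lookup_single when_def if_distrib[of cnj] cong: if_cong)
    have proportional: "u s * v t = v s * u t" if t: "t \<in> tableaux lam" for t
    proof -
      \<comment> \<open>The combination whose alternation vanishes at \<open>s\<close>; uniqueness
        then makes the alternation vanish everywhere.\<close>
      define g where "g = (\<lambda>r. u s * lookup f r - v s * w r)"
      have g_alt: "alternate lam s g r = u s * v r - v s * u r" for r
        unfolding g_def alternate_diff u_def v_def ..
      have "exchange_invariant lam g"
        using exch w_exch
        by (simp add: exchange_invariant_def exchange_sum_def g_def sum_subtractf flip: sum_distrib_left)
      hence "alternate lam s g t = 0"
        by (rule exchange_invariant_unique[OF exchange_invariant_alternate s alternate_comp _ t])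
          (simp_all add: g_alt mult.commute)
      thus ?thesis by (simp add: g_alt)
    qed
    have orth: "(\<Sum>t\<in>tableaux lam. lookup f t * u t) = 0"
    proof -
      \<comment> \<open>Translating \<open>w\<close> by \<open>q\<close> amounts to letting
        \<open>q\<close> act on the image of \<open>f\<close> in the tabloid module, and that image
        is 0.\<close>
      have *: "(\<Sum>t\<in>tableaux lam. lookup f t * w (q \<circ> t)) = 0" if "q \<in> C" for q
      proof -
        have q: "q permutes {1..sum_list lam}" using that column_stabilizerD(1) by (simp add: C_def)
        have "(\<Sum>t\<in>tableaux lam. lookup f t * w (q \<circ> t))
          = lookup (linear_extension (\<lambda>t. polytabloid lam (q \<circ> t)) f) (tabloid lam s)"
          by (simp add: w_def lookup_linear_extension[OF finite_tableaux f(1)])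
        also have "linear_extension (\<lambda>t. polytabloid lam (q \<circ> t)) f
          = linear_extension (\<lambda>t. linear_extension (\<lambda>U. Poly_Mapping.single (tabloid_act q U) 1) (polytabloid lam t)) f"
        proof (rule linear_extension_cong)
          fix t assume "t \<in> keys f"
          hence t: "t \<in> tableaux lam" using f(1) by blast
          show "polytabloid lam (q \<circ> t)
            = linear_extension (\<lambda>U. Poly_Mapping.single (tabloid_act q U) 1) (polytabloid lam t)"
            unfolding free_act_polytabloid[OF q t, symmetric] by (rule free_act_eq[OF keys_polytabloid[OF t]])
        qed
        also have "\<dots> = 0" by (simp add: f(2) flip: linear_extension_linear_extension)
        finally show ?thesis unfolding lookup_zero .
      qed
      have "(\<Sum>t\<in>tableaux lam. lookup f t * u t)
        = (\<Sum>q\<in>C. of_int (sign q) * (\<Sum>t\<in>tableaux lam. lookup f t * w (q \<circ> t)))"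
        unfolding u_def alternate_def C_def sum_distrib_left
        by (subst sum.swap) (simp add: mult.left_commute)
      thus ?thesis by (simp add: *)
    qed
    \<comment> \<open>As \<open>u\<close> alternates already, each \<open>q\<close> contributes the
      same amount, so pairing with \<open>v\<close> is pairing with \<open>lookup f\<close> up to
      the factor \<open>card C\<close>.\<close>
    have "(\<Sum>t\<in>tableaux lam. v t * u t) = (\<Sum>q\<in>C. \<Sum>t\<in>tableaux lam. of_int (sign q) * lookup f (q \<circ> t) * u t)"
      unfolding v_def alternate_def C_def sum_distrib_right by (rule sum.swap)
    also have "\<dots> = (\<Sum>q\<in>C. \<Sum>t\<in>tableaux lam. lookup f t * u t)"
    proof (rule sum.cong[OF refl])
      fix q assume q: "q \<in> C"
      have qp: "q permutes {1..sum_list lam}" using q column_stabilizerD(1) by (simp add: C_def)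
      have closed: "q \<circ> t \<in> tableaux lam" "inv' q \<circ> t \<in> tableaux lam" if "t \<in> tableaux lam" for t
        using that permutes_comp_tableau qp permutes_inv[OF qp] by blast+
      have "(\<Sum>t\<in>tableaux lam. of_int (sign q) * lookup f (q \<circ> t) * u t)
        = (\<Sum>t\<in>tableaux lam. lookup f (q \<circ> t) * u (q \<circ> t))"
        using q by (simp add: u_def alternate_comp C_def mult.left_commute mult.assoc)
      also have "\<dots> = (\<Sum>t\<in>tableaux lam. lookup f t * u t)"
        by (rule sum.reindex_bij_witness[of _ "\<lambda>t. inv' q \<circ> t" "\<lambda>t. q \<circ> t"])
          (simp_all add: closed o_assoc permutes_inv_o[OF qp])
      finally show "(\<Sum>t\<in>tableaux lam. of_int (sign q) * lookup f (q \<circ> t) * u t)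
        = (\<Sum>t\<in>tableaux lam. lookup f t * u t)" .
    qed
    finally have "(\<Sum>t\<in>tableaux lam. v t * u t) = 0" by (simp add: orth)
    hence "0 = (\<Sum>t\<in>tableaux lam. u s * v t * u t)" by (simp add: mult.assoc flip: sum_distrib_left)
    also have "\<dots> = v s * (\<Sum>t\<in>tableaux lam. u t * cnj (u t))"
      unfolding sum_distrib_left u_real by (intro sum.cong refl) (simp add: proportional)
    also have "(\<Sum>t\<in>tableaux lam. u t * cnj (u t)) = of_real (\<Sum>t\<in>tableaux lam. (cmod (u t))\<^sup>2)"
      unfolding of_real_sum complex_norm_square ..
    finally have "v s = 0 \<or> (\<Sum>t\<in>tableaux lam. (cmod (u t))\<^sup>2) = 0"
      by (metis mult_eq_0_iff of_real_eq_0_iff)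
    moreover have "(\<Sum>t\<in>tableaux lam. (cmod (u t))\<^sup>2) \<noteq> 0"
      using s us C finite_tableaux by (auto simp: sum_nonneg_eq_0_iff)
    ultimately show "lookup f s = 0" using vs C by auto
  qed
  moreover have "lookup f s = 0" if "s \<notin> tableaux lam" for s
    using f(1) that by (auto simp: in_keys_iff)
  ultimately show ?thesis by (intro poly_mapping_eqI) (metis lookup_zero)
qed

section \<open>Orthogonal decomposition\<close>

lemma submodule_free_moduleI:
  assumes "N \<subseteq> {f. keys f \<subseteq> A}" "0 \<in> N" "\<And>f g. f \<in> N \<Longrightarrow> g \<in> N \<Longrightarrow> f + g \<in> N"
    and scale: "\<And>a f. f \<in> N \<Longrightarrow> Poly_Mapping.map ((*) a) f \<in> N"
  shows "submodule N complex_ring (free_module A)"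
proof (rule free_module.submoduleI)
  fix f assume f: "f \<in> N"
  have "- f = Poly_Mapping.map ((*) (- 1)) f" by (rule poly_mapping_eqI) simp
  hence "- f \<in> N" using scale[OF f, of "- 1"] by simp
  thus "\<ominus>\<^bsub>free_module A\<^esub> f \<in> N" using assms(1) f by auto
qed (use assms in auto)

lemma submodule_free_moduleD:
  assumes "submodule N complex_ring (free_module A)"
  shows "f \<in> N \<Longrightarrow> keys f \<subseteq> A" "0 \<in> N" "f \<in> N \<Longrightarrow> g \<in> N \<Longrightarrow> f + g \<in> N"
    "f \<in> N \<Longrightarrow> Poly_Mapping.map ((*) a) f \<in> N"
  using free_module.submoduleE(1,4,5)[OF assms] subgroup.one_closed[OF submodule.axioms(1)[OF assms]] by auto

lemma kernel_submodule:
  "submodule {f. keys f \<subseteq> A \<and> linear_extension \<phi> f = 0} complex_ring (free_module A)"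
proof (rule submodule_free_moduleI)
  fix f g assume "f \<in> {f. keys f \<subseteq> A \<and> linear_extension \<phi> f = 0}" "g \<in> {f. keys f \<subseteq> A \<and> linear_extension \<phi> f = 0}"
  thus "f + g \<in> {f. keys f \<subseteq> A \<and> linear_extension \<phi> f = 0}"
    using keys_add[of f g] by (auto simp: linear_extension_add)
next
  fix a :: complex and f assume "f \<in> {f. keys f \<subseteq> A \<and> linear_extension \<phi> f = 0}"
  moreover have "Poly_Mapping.map ((*) a) 0 = (0 :: 'b \<Rightarrow>\<^sub>0 complex)" by (rule poly_mapping_eqI) simp
  ultimately show "Poly_Mapping.map ((*) a) f \<in> {f. keys f \<subseteq> A \<and> linear_extension \<phi> f = 0}"
    using keys_scale[of a f] by (auto simp: linear_extension_scale)
qed auto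

definition pairing :: "'a set \<Rightarrow> ('a \<Rightarrow>\<^sub>0 complex) \<Rightarrow> ('a \<Rightarrow>\<^sub>0 complex) \<Rightarrow> complex"
  where "pairing A f g = (\<Sum>x\<in>A. lookup f x * cnj (lookup g x))"

lemma pairing_diff_left: "pairing A (f - g) h = pairing A f h - pairing A g h"
  by (simp add: pairing_def lookup_minus left_diff_distrib sum_subtractf)

lemma pairing_scale_left: "pairing A (Poly_Mapping.map ((*) a) f) h = a * pairing A f h"
  by (simp add: pairing_def sum_distrib_left mult.assoc)

lemma pairing_add_right: "pairing A f (g + h) = pairing A f g + pairing A f h"
  by (simp add: pairing_def lookup_add ring_distribs sum.distrib)

lemma pairing_scale_right: "pairing A f (Poly_Mapping.map ((*) a) h) = cnj a * pairing A f h"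
  by (simp add: pairing_def sum_distrib_left mult_ac)

lemma pairing_diff_right: "pairing A f (g - h) = pairing A f g - pairing A f h"
  by (simp add: pairing_def lookup_minus right_diff_distrib sum_subtractf)

lemma pairing_sum_right: "pairing A f (\<Sum>i\<in>I. g i) = (\<Sum>i\<in>I. pairing A f (g i))"
  unfolding pairing_def lookup_sum cnj_sum sum_distrib_left by (rule sum.swap)

lemma pairing_single:
  assumes "finite A" "x \<in> A"
  shows "pairing A f (Poly_Mapping.single x a) = cnj a * lookup f x"
  using assms by (simp add: pairing_def lookup_single when_def if_distrib[of cnj] if_distrib[of "(*) _"] cong: if_cong)

lemma pairing_self_eq_0:
  assumes "finite A" "keys f \<subseteq> A" "pairing A f f = 0"
  shows "f = 0"
proof -
  have "pairing A f f = of_real (\<Sum>x\<in>A. (cmod (lookup f x))\<^sup>2)"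
    unfolding pairing_def of_real_sum complex_norm_square ..
  hence "(\<Sum>x\<in>A. (cmod (lookup f x))\<^sup>2) = 0" using assms(3) by (metis of_real_eq_0_iff)
  hence "lookup f x = 0" if "x \<in> A" for x
    using that assms(1) by (simp add: sum_nonneg_eq_0_iff)
  hence "lookup f x = 0" for x using assms(2) by (cases "x \<in> A") (auto simp: in_keys_iff)
  thus ?thesis by (intro poly_mapping_eqI) simp
qed

text \<open>The vectors orthogonal to \<open>f\<close> form a submodule, so the generators
  decide.\<close>

lemma pairing_generated:
  assumes "x \<in> generated_submodule complex_ring (free_module A) B" "\<And>b. b \<in> B \<Longrightarrow> pairing A f b = 0"
    and B: "B \<subseteq> {f. keys f \<subseteq> A}"
  shows "pairing A f x = 0"
proof -
  have "submodule {x. keys x \<subseteq> A \<and> pairing A f x = 0} complex_ring (free_module A)"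
  proof (rule submodule_free_moduleI)
    fix g h assume "g \<in> {x. keys x \<subseteq> A \<and> pairing A f x = 0}" "h \<in> {x. keys x \<subseteq> A \<and> pairing A f x = 0}"
    thus "g + h \<in> {x. keys x \<subseteq> A \<and> pairing A f x = 0}"
      using keys_add[of g h] by (auto simp: pairing_add_right)
  next
    fix a :: complex and g assume "g \<in> {x. keys x \<subseteq> A \<and> pairing A f x = 0}"
    thus "Poly_Mapping.map ((*) a) g \<in> {x. keys x \<subseteq> A \<and> pairing A f x = 0}"
      using keys_scale[of a g] by (auto simp: pairing_scale_right)
  qed (auto simp: pairing_def)
  moreover have "B \<subseteq> {x. keys x \<subseteq> A \<and> pairing A f x = 0}" using assms(2) B by auto
  ultimately have "generated_submodule complex_ring (free_module A) B \<subseteq> {x. keys x \<subseteq> A \<and> pairing A f x = 0}"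
    unfolding generated_submodule_def by (rule hull_minimal[rotated])
  thus ?thesis using assms(1) by blast
qed

lemma generated_submodule_free:
  assumes "B \<subseteq> {f. keys f \<subseteq> A}"
  shows "submodule (generated_submodule complex_ring (free_module A) B) complex_ring (free_module A)"
  using assms by (intro submodule_generated_submodule module_free_module) simp

text \<open>Gram-Schmidt, adding the generators one at a time.\<close>

lemma orthogonal_decomposition:
  assumes A: "finite A" and "finite B" "B \<subseteq> {f. keys f \<subseteq> A}"
  shows "\<exists>a\<in>generated_submodule complex_ring (free_module A) B. \<forall>b\<in>B. pairing A (f - a) b = 0"
  using assms(2,3)
proof (induction B arbitrary: f rule: finite_induct)
  case empty
  show ?case using submodule_free_moduleD(2)[OF generated_submodule_free] by blast
next
  case (insert b B)
  let ?G = "generated_submodule complex_ring (free_module A)"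
  have B: "B \<subseteq> {f. keys f \<subseteq> A}" and b: "keys b \<subseteq> A" using insert.prems by auto
  note G = submodule_free_moduleD[OF generated_submodule_free[OF insert.prems]]
  have GB: "?G B \<subseteq> ?G (insert b B)"
    unfolding generated_submodule_def by (intro hull_mono) auto
  have orth: "pairing A g x = 0" if "\<forall>b\<in>B. pairing A g b = 0" "x \<in> ?G B" for g x
    by (rule pairing_generated[OF that(2) _ B]) (use that(1) in blast)
  obtain a where a: "a \<in> ?G B" "\<forall>b\<in>B. pairing A (f - a) b = 0" using insert.IH[OF B] by blast
  \<comment> \<open>The induction hypothesis holds for every vector, in particular for the new
    generator \<open>b\<close>; subtracting \<open>c\<close> makes it orthogonal to the earlier
    ones.\<close>
  obtain c where c: "c \<in> ?G B" "\<forall>y\<in>B. pairing A (b - c) y = 0" using insert.IH[OF B] by blast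
  define b' where "b' = b - c"
  have b': "b' \<in> ?G (insert b B)"
  proof -
    have "b \<in> ?G (insert b B)" unfolding generated_submodule_def by (intro hull_inc) simp
    moreover have "b' = b + Poly_Mapping.map ((*) (- 1)) c"
      by (rule poly_mapping_eqI) (simp add: b'_def lookup_minus lookup_add)
    ultimately show ?thesis using G(3,4) c(1) GB by auto
  qed
  show ?case
  proof (cases "b' = 0")
    case True
    hence "b \<in> ?G B" using c(1) by (simp add: b'_def)
    thus ?thesis using a orth GB by blast
  next
    case False
    hence nz: "pairing A b' b' \<noteq> 0" using pairing_self_eq_0[OF A G(1)[OF b']] by blast
    \<comment> \<open>The coefficient of the projection of \<open>f - a\<close> onto
      \<open>b'\<close>.\<close>
    define k where "k = pairing A (f - a) b' / pairing A b' b'"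
    define a' where "a' = a + Poly_Mapping.map ((*) k) b'"
    have fa': "f - a' = f - a - Poly_Mapping.map ((*) k) b'" by (simp add: a'_def)
    have B0: "pairing A (f - a') y = 0" if "y \<in> B" for y
      using that a c by (simp add: fa' pairing_diff_left pairing_scale_left b'_def)
    have "pairing A (f - a') b' = 0"
      using nz unfolding fa' by (simp add: pairing_diff_left[of A "f - a"] pairing_scale_left k_def)
    moreover have "pairing A (f - a') c = 0" using B0 c by (intro orth) auto
    moreover have "b = b' + c" by (simp add: b'_def)
    ultimately have "pairing A (f - a') b = 0" by (simp add: pairing_add_right)
    moreover have "a' \<in> ?G (insert b B)" unfolding a'_def using G(3,4) a b' GB by blast
    ultimately show ?thesis using B0 by blast
  qed
qed

section \<open>The presentation of the Specht module\<close>

text \<open>A representative of \<open>g_tilde\<close> in the free module, before column relations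
  are divided out.\<close>

definition exchange_relation :: "nat list \<Rightarrow> nat \<Rightarrow> tableau \<Rightarrow> tableau \<Rightarrow>\<^sub>0 complex"
  where "exchange_relation lam c t =
    Poly_Mapping.single t (of_nat ((c - 1) * card (diagram_column lam c)))
      - (\<Sum>s\<in>left_switches lam c t. Poly_Mapping.single s 1)"

lemma left_switches_tableaux:
  "t \<in> tableaux lam \<Longrightarrow> left_switches lam c t \<subseteq> tableaux lam"
  by (auto simp: left_switches_def intro!: switch_tableaux column_in_diagram)

lemma finite_left_switches: "t \<in> tableaux lam \<Longrightarrow> finite (left_switches lam c t)"
  using finite_subset[OF left_switches_tableaux finite_tableaux] .

lemma keys_diff_subset:
  "keys f \<subseteq> A \<Longrightarrow> keys g \<subseteq> A \<Longrightarrow> keys (f - g :: 'a \<Rightarrow>\<^sub>0 complex) \<subseteq> A"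
  using keys_diff[of f g] by blast

lemma keys_sum_singles: "keys (\<Sum>s\<in>S. Poly_Mapping.single s (1 :: complex)) \<subseteq> S"
  by (rule order_trans[OF keys_sum]) auto

lemma keys_exchange_relation:
  "t \<in> tableaux lam \<Longrightarrow> keys (exchange_relation lam c t) \<subseteq> tableaux lam"
  unfolding exchange_relation_def
  using left_switches_tableaux by (intro keys_diff_subset order_trans[OF keys_sum_singles]) auto

text \<open>Rows are initial segments, so a cell in column \<open>c\<close> forces all columns from
  1 to \<open>c\<close> to be occupied.\<close>

lemma column_le_num_columns:
  assumes "diagram_column lam c \<noteq> {}"
  shows "c \<le> num_columns lam"
proof -
  obtain i where i: "(i, c) \<in> diagram lam" using assms by (auto simp: diagram_column_def)
  have "j \<in> snd ` diagram lam" if "j \<in> {1..c}" for j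
  proof -
    have "(i, j) \<in> diagram lam" using i that by (auto simp: diagram_def)
    thus ?thesis by force
  qed
  hence "card {1..c} \<le> card (snd ` diagram lam)"
    by (intro card_mono finite_imageI finite_diagram) blast
  thus ?thesis by (simp add: num_columns_def)
qed

text \<open>Stated for any submodule \<open>N\<close> between the relations and the kernel, so that
  it applies to the preimage of \<open>g_tilde_relations\<close> in the free module. Splitting
  \<open>f\<close> into a combination \<open>a\<close> of relations and an orthogonal rest
  \<open>v\<close> leaves \<open>v\<close> in the kernel, where orthogonality to the relations
  forces it to be 0.\<close>

lemma polytabloid_kernel_subset:
  assumes N: "submodule N complex_ring (free_module (tableaux lam))"
    and N0: "\<And>f. f \<in> N \<Longrightarrow> linear_extension (polytabloid lam) f = 0"
    and col: "\<And>t x y c. t \<in> tableaux lam \<Longrightarrow> x \<in> diagram_column lam c \<Longrightarrow> y \<in> diagram_column lam c \<Longrightarrow> x \<noteq> y \<Longrightarrow>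
      Poly_Mapping.single t 1 + Poly_Mapping.single (switch x y t) 1 \<in> N"
    and exch: "\<And>t c. t \<in> tableaux lam \<Longrightarrow> 2 \<le> c \<Longrightarrow> c \<le> num_columns lam \<Longrightarrow> exchange_relation lam c t \<in> N"
    and f: "keys f \<subseteq> tableaux lam" "linear_extension (polytabloid lam) f = 0"
  shows "f \<in> N"
proof -
  define B where "B = {Poly_Mapping.single t 1 + Poly_Mapping.single (switch x y t) (1 :: complex) | t x y c.
      t \<in> tableaux lam \<and> x \<in> diagram_column lam c \<and> y \<in> diagram_column lam c \<and> x \<noteq> y}
    \<union> {exchange_relation lam c t | c t. t \<in> tableaux lam \<and> 2 \<le> c \<and> c \<le> num_columns lam}"
  \<comment> \<open>\<open>orthogonal_decomposition\<close> asks for finitely many generators; these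
    are indexed by tableaux, cells and columns.\<close>
  have "B \<subseteq> (\<Union>t\<in>tableaux lam. \<Union>x\<in>diagram lam. \<Union>y\<in>diagram lam.
      {Poly_Mapping.single t 1 + Poly_Mapping.single (switch x y t) 1})
    \<union> (\<Union>t\<in>tableaux lam. \<Union>c\<in>{..num_columns lam}. {exchange_relation lam c t})"
    unfolding B_def by (blast dest: column_in_diagram)
  hence fin: "finite B"
    by (rule finite_subset) (simp add: finite_tableaux finite_diagram)
  have BN: "B \<subseteq> N" unfolding B_def using col exch by blast
  hence BT: "B \<subseteq> {f. keys f \<subseteq> tableaux lam}" using submodule_free_moduleD(1)[OF N] by blast
  obtain a where a: "a \<in> generated_submodule complex_ring (free_module (tableaux lam)) B"
    "\<And>b. b \<in> B \<Longrightarrow> pairing (tableaux lam) (f - a) b = 0"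
    using orthogonal_decomposition[OF finite_tableaux fin BT] by blast
  have aN: "a \<in> N" using a(1) hull_minimal[OF BN, of "\<lambda>N. submodule N complex_ring (free_module (tableaux lam))"] N
    unfolding generated_submodule_def by blast
  define v where "v = f - a"
  \<comment> \<open>Subtracting \<open>a\<close> does not leave the kernel, because \<open>a\<close>
    lies in \<open>N\<close>.\<close>
  have v: "keys v \<subseteq> tableaux lam" "linear_extension (polytabloid lam) v = 0"
    using f N0[OF aN] submodule_free_moduleD(1)[OF N aN]
    by (simp_all add: v_def keys_diff_subset linear_extension_diff)
  have "column_antisymmetric lam (lookup v)"
    unfolding column_antisymmetric_def
  proof (intro ballI allI impI)
    fix t c x y
    assume *: "t \<in> tableaux lam" "x \<in> diagram_column lam c" "y \<in> diagram_column lam c" "x \<noteq> y"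
    hence st: "switch x y t \<in> tableaux lam" using column_in_diagram by (intro switch_tableaux)
    have "Poly_Mapping.single t 1 + Poly_Mapping.single (switch x y t) 1 \<in> B"
      unfolding B_def using * by blast
    from a(2)[OF this] show "lookup v (switch x y t) = - lookup v t"
      using * st by (simp add: v_def pairing_add_right pairing_single finite_tableaux eq_neg_iff_add_eq_0 add.commute)
  qed
  moreover from this have "exchange_invariant lam (lookup v)"
  proof (rule exchange_invariantI)
    fix t c assume *: "t \<in> tableaux lam" "2 \<le> c" "diagram_column lam c \<noteq> {}"
    have "exchange_relation lam c t \<in> B"
      unfolding B_def using * column_le_num_columns by blast
    hence "pairing (tableaux lam) v (exchange_relation lam c t) = 0" using a(2) by (simp add: v_def)
    thus "of_nat ((c - 1) * card (diagram_column lam c)) * lookup v t = (\<Sum>s\<in>left_switches lam c t. lookup v s)"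
      using * left_switches_tableaux
      by (simp add: exchange_relation_def pairing_diff_right pairing_sum_right
          pairing_single finite_tableaux subset_iff)
  qed
  ultimately have "v = 0" using v by (intro exchange_invariant_kernel_trivial)
  thus ?thesis using aN by (simp add: v_def)
qed

text \<open>By \<open>polytabloid_exchange\<close> every cell of column \<open>c\<close> paired with
  a column to its left contributes one polytabloid of \<open>t\<close>; the coefficient
  \<open>(c - 1) * card (diagram_column lam c)\<close> counts these pairs.\<close>

lemma linear_extension_exchange_relation:
  assumes t: "t \<in> tableaux lam"
  shows "linear_extension (polytabloid lam) (exchange_relation lam c t) = 0"
proof (rule poly_mapping_eqI)
  fix U
  have "(\<Sum>s\<in>left_switches lam c t. polytabloid lam s)
    = (\<Sum>c'\<in>{1..<c}. \<Sum>x\<in>diagram_column lam c. polytabloid lam t)"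
    unfolding left_switches_sum[OF t] by (intro sum.cong refl polytabloid_exchange[OF t]) auto
  hence "lookup (\<Sum>s\<in>left_switches lam c t. polytabloid lam s) U
    = of_nat ((c - 1) * card (diagram_column lam c)) * lookup (polytabloid lam t) U"
    by (simp add: lookup_sum)
  thus "lookup (linear_extension (polytabloid lam) (exchange_relation lam c t)) U = lookup 0 U"
    by (simp add: exchange_relation_def linear_extension_diff linear_extension_sum lookup_minus)
qed

lemma linear_extension_column_relation:
  assumes "t \<in> tableaux lam" "x \<in> diagram_column lam c" "y \<in> diagram_column lam c" "x \<noteq> y"
  shows "linear_extension (polytabloid lam) (Poly_Mapping.single t 1 + Poly_Mapping.single (switch x y t) 1) = 0"
proof (rule poly_mapping_eqI)
  fix U
  show "lookup (linear_extension (polytabloid lam) (Poly_Mapping.single t 1 + Poly_Mapping.single (switch x y t) 1)) U = lookup 0 U"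
    using column_antisymmetric_lookup_polytabloid[of lam U] assms
    by (simp add: linear_extension_add lookup_add column_antisymmetric_def)
qed

section \<open>Equivariance of the relations and of the map to polytabloids\<close>

lemma tableaux_representation:
  "linear_representation complex_ring (free_module (tableaux lam)) (sym_group (sum_list lam))
    (free_act (tableaux lam) tableau_act)"
  by (rule free_representation[OF sym_group_is_group])
    (simp_all add: sym_group_carrier sym_group_one sym_group_mult tableau_act_def comp_assoc permutes_comp_tableau
      del: One_nat_def)

lemma tabloids_representation:
  "linear_representation complex_ring (free_module (tabloids lam)) (sym_group (sum_list lam))
    (free_act (tabloids lam) tabloid_act)"
proof (rule free_representation[OF sym_group_is_group])
  fix g U assume "g \<in> carrier (sym_group (sum_list lam))" "U \<in> tabloids lam"
  thus "tabloid_act g U \<in> tabloids lam"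
    using tabloid_act_tabloid permutes_comp_tableau by (fastforce simp: tabloids_def sym_group_carrier)
qed (simp_all add: tabloid_act_def tableau_act_def sym_group_one sym_group_mult image_image comp_assoc)

lemma free_act_single:
  "x \<in> A \<Longrightarrow> free_act A \<alpha> g (Poly_Mapping.single x a) = Poly_Mapping.single (\<alpha> g x) a"
  by (subst free_act_eq) auto

lemma switch_comp: "switch x y (g \<circ> t) = g \<circ> switch x y t"
  by (simp add: switch_def comp_assoc)

text \<open>Switching cells commutes with permuting entries, so \<open>g\<close> sends the column
  relation of \<open>t\<close> to that of \<open>g \<circ> t\<close>.\<close>

lemma column_relations_invariant:
  "invariant_submodule complex_ring (free_module (tableaux lam)) (sym_group (sum_list lam))
    (free_act (tableaux lam) tableau_act) (column_relations lam)"
proof -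
  interpret linear_representation complex_ring "free_module (tableaux lam)" "sym_group (sum_list lam)"
    "free_act (tableaux lam) tableau_act"
    by (rule tableaux_representation)
  let ?A = "{Poly_Mapping.single t (1 :: complex) + Poly_Mapping.single (switch x y t) 1 | t x y c.
       t \<in> tableaux lam \<and> x \<in> diagram_column lam c \<and> y \<in> diagram_column lam c \<and> x \<noteq> y}"
  have keys: "keys (Poly_Mapping.single t (1 :: complex) + Poly_Mapping.single (switch x y t) 1) \<subseteq> tableaux lam"
    if "t \<in> tableaux lam" "x \<in> diagram_column lam c" "y \<in> diagram_column lam c" for t x y c
    using that by (intro order_trans[OF keys_add]) (simp add: switch_tableaux column_in_diagram)
  show ?thesis
    unfolding column_relations_def
  proof (rule generated_submodule_invariant)
    show "?A \<subseteq> carrier (free_module (tableaux lam))"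
      unfolding free_module_sels using keys by blast
  next
    fix g f assume g: "g \<in> carrier (sym_group (sum_list lam))" and "f \<in> ?A"
    then obtain t x y c where f: "f = Poly_Mapping.single t 1 + Poly_Mapping.single (switch x y t) 1"
      and t: "t \<in> tableaux lam" and xy: "x \<in> diagram_column lam c" "y \<in> diagram_column lam c" "x \<noteq> y"
      by blast
    have st: "switch x y t \<in> tableaux lam" using t xy column_in_diagram by (intro switch_tableaux)
    have "free_act (tableaux lam) tableau_act g f
      = Poly_Mapping.single (g \<circ> t) 1 + Poly_Mapping.single (switch x y (g \<circ> t)) 1"
      using act_add[OF g, of "Poly_Mapping.single t 1" "Poly_Mapping.single (switch x y t) 1"] t st
      by (simp add: f free_act_single tableau_act_def switch_comp)
    moreover have "g \<circ> t \<in> tableaux lam" using g t by (intro permutes_comp_tableau) (simp only: sym_group_carrier)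
    ultimately have "free_act (tableaux lam) tableau_act g f \<in> ?A" using xy by blast
    thus "free_act (tableaux lam) tableau_act g f
      \<in> generated_submodule complex_ring (free_module (tableaux lam)) ?A"
      unfolding generated_submodule_def by (rule hull_inc)
  qed
qed

lemma specht_invariant:
  "invariant_submodule complex_ring (free_module (tabloids lam)) (sym_group (sum_list lam))
    (free_act (tabloids lam) tabloid_act)
    (generated_submodule complex_ring (free_module (tabloids lam)) (polytabloid lam ` tableaux lam))"
proof (rule linear_representation.generated_submodule_invariant[OF tabloids_representation])
  show "polytabloid lam ` tableaux lam \<subseteq> carrier (free_module (tabloids lam))"
    using keys_polytabloid by auto
next
  fix g f assume "g \<in> carrier (sym_group (sum_list lam))" "f \<in> polytabloid lam ` tableaux lam"
  then obtain t where "g permutes {1..sum_list lam}" "t \<in> tableaux lam" "f = polytabloid lam t"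
    by (auto simp only: sym_group_carrier)
  hence "free_act (tabloids lam) tabloid_act g f \<in> polytabloid lam ` tableaux lam"
    using free_act_polytabloid permutes_comp_tableau by blast
  thus "free_act (tabloids lam) tabloid_act g f
    \<in> generated_submodule complex_ring (free_module (tabloids lam)) (polytabloid lam ` tableaux lam)"
    unfolding generated_submodule_def by (rule hull_inc)
qed

lemma specht_representation:
  "linear_representation complex_ring (specht_module lam) (sym_group (sum_list lam)) (specht_act lam)"
proof -
  have "specht_act lam = (\<lambda>g. restrict (free_act (tabloids lam) tabloid_act g)
    (generated_submodule complex_ring (free_module (tabloids lam)) (polytabloid lam ` tableaux lam)))"
    by (simp add: fun_eq_iff specht_act_def specht_module_def)
  thus ?thesis
    using invariant_submodule.restrict_representation[OF specht_invariant, of lam]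
    by (simp add: specht_module_def)
qed

text \<open>The span of the polytabloids becomes the image of a linear map, which gives surjectivity
  in the final isomorphism.\<close>

lemma specht_carrier:
  "carrier (specht_module lam) = linear_extension (polytabloid lam) ` {f. keys f \<subseteq> tableaux lam}"
proof
  let ?S = "linear_extension (polytabloid lam) ` {f. keys f \<subseteq> tableaux lam}"
  let ?G = "generated_submodule complex_ring (free_module (tabloids lam)) (polytabloid lam ` tableaux lam)"
  have carrier: "carrier (specht_module lam) = ?G" by (simp add: specht_module_def)
  have gen: "polytabloid lam ` tableaux lam \<subseteq> {f. keys f \<subseteq> tabloids lam}"
    using keys_polytabloid by blast
  have "submodule ?S complex_ring (free_module (tabloids lam))"
  proof (rule submodule_free_moduleI)
    show "?S \<subseteq> {f. keys f \<subseteq> tabloids lam}"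
      using keys_polytabloid by (auto dest!: subsetD intro!: keys_linear_extension)
    show "0 \<in> ?S" by (rule image_eqI[of _ _ 0]) auto
  next
    fix f g assume "f \<in> ?S" "g \<in> ?S"
    then obtain f' g' where "f = linear_extension (polytabloid lam) f'" "keys f' \<subseteq> tableaux lam"
      "g = linear_extension (polytabloid lam) g'" "keys g' \<subseteq> tableaux lam" by auto
    thus "f + g \<in> ?S"
      using keys_add[of f' g'] by (intro image_eqI[of _ _ "f' + g'"]) (auto simp: linear_extension_add)
  next
    fix a :: complex and f assume "f \<in> ?S"
    then obtain f' where "f = linear_extension (polytabloid lam) f'" "keys f' \<subseteq> tableaux lam" by auto
    thus "Poly_Mapping.map ((*) a) f \<in> ?S"
      using keys_scale[of a f']
      by (intro image_eqI[of _ _ "Poly_Mapping.map ((*) a) f'"]) (auto simp: linear_extension_scale)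
  qed
  moreover have "polytabloid lam ` tableaux lam \<subseteq> ?S"
  proof
    fix f assume "f \<in> polytabloid lam ` tableaux lam"
    then obtain t where "t \<in> tableaux lam" "f = polytabloid lam t" by blast
    thus "f \<in> ?S" by (intro image_eqI[of _ _ "Poly_Mapping.single t 1"]) simp_all
  qed
  ultimately show "carrier (specht_module lam) \<subseteq> ?S"
    unfolding carrier generated_submodule_def by (rule hull_minimal[rotated])
  note G = submodule_free_moduleD[OF generated_submodule_free[OF gen]]
  have "(\<Sum>x\<in>K. Poly_Mapping.map ((*) (a x)) (polytabloid lam x)) \<in> ?G" if "finite K" "K \<subseteq> tableaux lam" for K a
    using that
  proof (induction rule: finite_induct)
    case empty
    show ?case using G(2) by simp
  next
    case (insert x K)
    have "polytabloid lam x \<in> ?G"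
      unfolding generated_submodule_def using insert.prems by (intro hull_inc) simp
    thus ?case using insert G(3,4) by simp
  qed
  thus "?S \<subseteq> carrier (specht_module lam)"
    unfolding carrier linear_extension_def[abs_def] by (auto simp: image_subset_iff)
qed

lemma specht_sels [simp]:
  "f \<oplus>\<^bsub>specht_module lam\<^esub> g = f + g" "\<zero>\<^bsub>specht_module lam\<^esub> = 0"
  "a \<odot>\<^bsub>specht_module lam\<^esub> f = Poly_Mapping.map ((*) a) f"
  by (simp_all add: specht_module_def)

text \<open>Pulls the operations of \<open>column_module\<close> back along the coset map, so that
  all computations with \<open>g_tilde\<close> take place in the free module.\<close>

lemma g_tilde_eq_coset:
  assumes t: "t \<in> tableaux lam"
  shows "g_tilde lam c t = column_relations lam +>\<^bsub>free_module (tableaux lam)\<^esub> exchange_relation lam c t"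
proof -
  interpret invariant_submodule complex_ring "free_module (tableaux lam)" "sym_group (sum_list lam)"
    "free_act (tableaux lam) tableau_act" "column_relations lam"
    by (rule column_relations_invariant)
  let ?F = "free_module (tableaux lam)"
  let ?k = "of_nat ((c - 1) * card (diagram_column lam c)) :: complex"
  have k: "?k \<odot>\<^bsub>column_module lam\<^esub> tableau_class lam t = column_relations lam +>\<^bsub>?F\<^esub> Poly_Mapping.single t ?k"
    unfolding column_module_def tableau_class_def
    by (subst quotient_smult) (use t in simp_all)
  have "(\<Oplus>\<^bsub>column_module lam\<^esub>s\<in>left_switches lam c t. tableau_class lam s)
    = column_relations lam +>\<^bsub>?F\<^esub> finsum ?F (\<lambda>s. Poly_Mapping.single s 1) (left_switches lam c t)"
    unfolding column_module_def tableau_class_def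
    by (rule coset_finsum[symmetric]) (use subsetD[OF left_switches_tableaux[OF t]] finite_left_switches[OF t] in auto)
  also have "finsum ?F (\<lambda>s. Poly_Mapping.single s 1) (left_switches lam c t) = (\<Sum>s\<in>left_switches lam c t. Poly_Mapping.single s 1)"
    by (rule free_module_finsum) (use subsetD[OF left_switches_tableaux[OF t]] finite_left_switches[OF t] in auto)
  finally have sum: "(\<Oplus>\<^bsub>column_module lam\<^esub>s\<in>left_switches lam c t. tableau_class lam s)
    = column_relations lam +>\<^bsub>?F\<^esub> (\<Sum>s\<in>left_switches lam c t. Poly_Mapping.single s 1)" .
  have keys: "keys (Poly_Mapping.single t ?k) \<subseteq> tableaux lam"
    "keys (\<Sum>s\<in>left_switches lam c t. Poly_Mapping.single s (1 :: complex)) \<subseteq> tableaux lam"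
    using t order_trans[OF keys_sum_singles left_switches_tableaux[OF t]] by auto
  show ?thesis
    unfolding g_tilde_def k sum unfolding column_module_def
    by (subst coset_minus[symmetric]) (use keys in \<open>simp_all add: exchange_relation_def\<close>)
qed

lemma free_act_exchange_relation:
  assumes g: "g permutes {1..sum_list lam}" and t: "t \<in> tableaux lam"
  shows "free_act (tableaux lam) tableau_act g (exchange_relation lam c t) = exchange_relation lam c (g \<circ> t)"
proof -
  have inj: "inj_on (\<lambda>s. g \<circ> s) S" for S
    using permutes_inj[OF g] by (auto simp: inj_on_def fun_eq_iff inj_def)
  have eq: "left_switches lam c (g \<circ> t) = (\<lambda>s. g \<circ> s) ` left_switches lam c t"
    unfolding left_switches_def switch_comp by blast
  have "free_act (tableaux lam) tableau_act g (exchange_relation lam c t)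
    = linear_extension (\<lambda>s. Poly_Mapping.single (g \<circ> s) 1) (exchange_relation lam c t)"
    by (simp add: free_act_eq[OF keys_exchange_relation[OF t]] tableau_act_def)
  also have "\<dots> = exchange_relation lam c (g \<circ> t)"
    unfolding exchange_relation_def eq linear_extension_diff linear_extension_sum
    by (simp add: sum.reindex[OF inj])
  finally show ?thesis .
qed

text \<open>Both sides are linear in \<open>f\<close>, and on a single tableau the claim is
  \<open>free_act_polytabloid\<close>. Membership of the image in the carrier is established because
  \<open>specht_act\<close> is a restricted function.\<close>

lemma linear_extension_free_act:
  assumes g: "g permutes {1..sum_list lam}" and f: "keys f \<subseteq> tableaux lam"
  shows "linear_extension (polytabloid lam) (free_act (tableaux lam) tableau_act g f)
    = specht_act lam g (linear_extension (polytabloid lam) f)"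
proof -
  let ?e = "linear_extension (polytabloid lam) f"
  have e: "?e \<in> carrier (specht_module lam)" using f by (auto simp: specht_carrier)
  have "keys ?e \<subseteq> tabloids lam"
    by (rule keys_linear_extension) (use f keys_polytabloid in blast)
  hence "specht_act lam g ?e
    = linear_extension (\<lambda>t. linear_extension (\<lambda>U. Poly_Mapping.single (tabloid_act g U) 1) (polytabloid lam t)) f"
    using e by (simp add: specht_act_def free_act_eq linear_extension_linear_extension)
  also have "\<dots> = linear_extension (\<lambda>t. polytabloid lam (g \<circ> t)) f"
  proof (rule linear_extension_cong)
    fix t assume "t \<in> keys f"
    hence t: "t \<in> tableaux lam" using f by blast
    show "linear_extension (\<lambda>U. Poly_Mapping.single (tabloid_act g U) 1) (polytabloid lam t) = polytabloid lam (g \<circ> t)"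
      unfolding free_act_polytabloid[OF g t, symmetric] by (rule free_act_eq[OF keys_polytabloid[OF t], symmetric])
  qed
  also have "\<dots> = linear_extension (polytabloid lam) (free_act (tableaux lam) tableau_act g f)"
    using f by (simp add: free_act_eq linear_extension_linear_extension tableau_act_def)
  finally show ?thesis by simp
qed

lemma column_relations_kernel:
  assumes "f \<in> column_relations lam"
  shows "keys f \<subseteq> tableaux lam \<and> linear_extension (polytabloid lam) f = 0"
proof -
  have "column_relations lam \<subseteq> {f. keys f \<subseteq> tableaux lam \<and> linear_extension (polytabloid lam) f = 0}"
    unfolding column_relations_def generated_submodule_def
  proof (rule hull_minimal[of _ _ "\<lambda>N. submodule N complex_ring (free_module (tableaux lam))"])
    show "submodule {f. keys f \<subseteq> tableaux lam \<and> linear_extension (polytabloid lam) f = 0}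
      complex_ring (free_module (tableaux lam))" by (rule kernel_submodule)
  next
    show "{Poly_Mapping.single t 1 + Poly_Mapping.single (switch x y t) 1 | t x y c.
       t \<in> tableaux lam \<and> x \<in> diagram_column lam c \<and> y \<in> diagram_column lam c \<and> x \<noteq> y}
      \<subseteq> {f. keys f \<subseteq> tableaux lam \<and> linear_extension (polytabloid lam) f = 0}"
    proof
      fix f :: "tableau \<Rightarrow>\<^sub>0 complex"
      assume "f \<in> {Poly_Mapping.single t 1 + Poly_Mapping.single (switch x y t) 1 | t x y c.
         t \<in> tableaux lam \<and> x \<in> diagram_column lam c \<and> y \<in> diagram_column lam c \<and> x \<noteq> y}"
      then obtain t x y c where f: "f = Poly_Mapping.single t 1 + Poly_Mapping.single (switch x y t) 1"
        and *: "t \<in> tableaux lam" "x \<in> diagram_column lam c" "y \<in> diagram_column lam c" "x \<noteq> y"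
        by blast
      have "keys f \<subseteq> tableaux lam"
        unfolding f using * by (intro order_trans[OF keys_add]) (simp add: switch_tableaux column_in_diagram)
      thus "f \<in> {f. keys f \<subseteq> tableaux lam \<and> linear_extension (polytabloid lam) f = 0}"
        using linear_extension_column_relation[OF *] f by simp
    qed
  qed
  thus ?thesis using assms by blast
qed

text \<open>Of the two successive quotients only the second is treated by the first isomorphism
  theorem: the map to polytabloids first descends to \<open>column_module\<close>, and its kernel
  there is computed by lifting to the free module.\<close>

theorem theorem2p3:
  fixes lam :: "nat list" and n :: nat
  assumes "is_partition lam n"
  shows "isomorphic_representations complex_ring (sym_group n)
    (S_tilde lam) (S_tilde_act lam) (specht_module lam) (specht_act lam)"
proof -
  have n: "n = sum_list lam" using assms by (simp add: is_partition_def)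
  let ?F = "free_module (tableaux lam)" and ?G = "sym_group (sum_list lam)"
  let ?cls = "\<lambda>f. column_relations lam +>\<^bsub>?F\<^esub> f"
  let ?\<Phi> = "linear_extension (polytabloid lam)"
  interpret F: invariant_submodule complex_ring ?F ?G "free_act (tableaux lam) tableau_act" "column_relations lam"
    by (rule column_relations_invariant)
  have M: "linear_representation complex_ring (column_module lam) ?G (column_module_act lam)"
    unfolding column_module_def column_module_act_def by (rule F.quotient_representation)
  interpret M: linear_representation complex_ring "column_module lam" ?G "column_module_act lam" by (rule M)
  interpret S: linear_representation complex_ring "specht_module lam" ?G "specht_act lam"
    by (rule specht_representation)
  have carrierM: "carrier (column_module lam) = ?cls ` {f. keys f \<subseteq> tableaux lam}"
    unfolding column_module_def F.quotient_carrier by simp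
  have addM: "?cls f \<oplus>\<^bsub>column_module lam\<^esub> ?cls g = ?cls (f + g)"
    if "keys f \<subseteq> tableaux lam" "keys g \<subseteq> tableaux lam" for f g
    using that F.quotient_add[of f g] unfolding column_module_def by simp
  have smultM: "a \<odot>\<^bsub>column_module lam\<^esub> ?cls f = ?cls (Poly_Mapping.map ((*) a) f)"
    if "keys f \<subseteq> tableaux lam" for a f
    using that F.quotient_smult[of a f] unfolding column_module_def by simp
  have zeroM: "\<zero>\<^bsub>column_module lam\<^esub> = ?cls 0"
    using F.coset_zero unfolding column_module_def by simp
  have actM: "column_module_act lam g (?cls f) = ?cls (free_act (tableaux lam) tableau_act g f)"
    if "g permutes {1..sum_list lam}" "keys f \<subseteq> tableaux lam" for g f
    using that F.quotient_act_coset[of g f] unfolding column_module_act_def by (simp add: sym_group_carrier)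
  have gens: "{g_tilde lam c t | c t. t \<in> tableaux lam \<and> 2 \<le> c \<and> c \<le> num_columns lam} \<subseteq> carrier (column_module lam)"
    using keys_exchange_relation by (auto simp: carrierM g_tilde_eq_coset)
  have inv: "invariant_submodule complex_ring (column_module lam) ?G (column_module_act lam) (g_tilde_relations lam)"
    unfolding g_tilde_relations_def
  proof (rule M.generated_submodule_invariant[OF gens])
    fix g A assume "g \<in> carrier ?G" "A \<in> {g_tilde lam c t | c t. t \<in> tableaux lam \<and> 2 \<le> c \<and> c \<le> num_columns lam}"
    then obtain c t where g: "g permutes {1..sum_list lam}" and A: "A = g_tilde lam c t"
      and t: "t \<in> tableaux lam" and c: "2 \<le> c" "c \<le> num_columns lam"
      unfolding sym_group_carrier by blast
    have gt: "g \<circ> t \<in> tableaux lam" by (rule permutes_comp_tableau[OF g t])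
    have "column_module_act lam g A = g_tilde lam c (g \<circ> t)"
      unfolding A g_tilde_eq_coset[OF t] g_tilde_eq_coset[OF gt]
        actM[OF g keys_exchange_relation[OF t]] free_act_exchange_relation[OF g t] ..
    thus "column_module_act lam g A \<in> generated_submodule complex_ring (column_module lam)
      {g_tilde lam c t | c t. t \<in> tableaux lam \<and> 2 \<le> c \<and> c \<le> num_columns lam}"
      unfolding generated_submodule_def using gt c by (intro hull_inc) blast
  qed
  then interpret Q: invariant_submodule complex_ring "column_module lam" ?G "column_module_act lam" "g_tilde_relations lam" .
  \<comment> \<open>The map to polytabloids on column classes; by
    \<open>column_relations_kernel\<close> it is constant on each class.\<close>
  define h where "h A = the_elem (?\<Phi> ` A)" for A
  have h: "h (?cls f) = ?\<Phi> f" if "keys f \<subseteq> tableaux lam" for f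
    unfolding h_def
  proof (rule F.the_elem_image_coset[where W = "specht_module lam"])
    show "abelian_group (specht_module lam)" by (rule S.M.abelian_group_axioms)
  qed (use that in \<open>auto simp: linear_extension_add specht_carrier column_relations_kernel\<close>)
  have keys_smult: "keys (Poly_Mapping.map ((*) a) f) \<subseteq> tableaux lam" if "keys f \<subseteq> tableaux lam" for a :: complex and f
    by (rule order_trans[OF keys_scale that])
  have keys_plus: "keys (f + g) \<subseteq> tableaux lam" if "keys f \<subseteq> tableaux lam" "keys g \<subseteq> tableaux lam" for f g :: "tableau \<Rightarrow>\<^sub>0 complex"
    using keys_add[of f g] that by blast
  \<comment> \<open>The classes killed by \<open>h\<close> form a submodule that contains the
    generators, by the exchange relations for polytabloids.\<close>
  have h_zero: "g_tilde_relations lam \<subseteq> {A \<in> carrier (column_module lam). h A = 0}"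
    unfolding g_tilde_relations_def generated_submodule_def
  proof (rule hull_minimal)
    show "{g_tilde lam c t |c t. t \<in> tableaux lam \<and> 2 \<le> c \<and> c \<le> num_columns lam}
      \<subseteq> {A \<in> carrier (column_module lam). h A = 0}"
      using gens h keys_exchange_relation
      by (auto simp: g_tilde_eq_coset linear_extension_exchange_relation)
    have smult: "a \<odot>\<^bsub>column_module lam\<^esub> A \<in> {A \<in> carrier (column_module lam). h A = 0}"
      if A: "A \<in> {A \<in> carrier (column_module lam). h A = 0}" for a A
    proof -
      obtain f where f: "A = ?cls f" "keys f \<subseteq> tableaux lam" using A unfolding carrierM by blast
      have "?\<Phi> f = 0" using A f h by simp
      hence "?\<Phi> (Poly_Mapping.map ((*) a) f) = 0"
        using submodule_free_moduleD(4)[OF kernel_submodule, of f "tableaux lam" "polytabloid lam" a] f(2) by simp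
      hence "h (a \<odot>\<^bsub>column_module lam\<^esub> A) = 0" using f h keys_smult by (simp add: smultM)
      thus ?thesis using A by simp
    qed
    show "submodule {A \<in> carrier (column_module lam). h A = 0} complex_ring (column_module lam)"
    proof (rule M.submoduleI)
      show "\<zero>\<^bsub>column_module lam\<^esub> \<in> {A \<in> carrier (column_module lam). h A = 0}"
        using h[of 0] M.M.zero_closed by (simp add: zeroM)
    next
      fix A B assume AB: "A \<in> {A \<in> carrier (column_module lam). h A = 0}" "B \<in> {A \<in> carrier (column_module lam). h A = 0}"
      then obtain f g where "A = ?cls f" "keys f \<subseteq> tableaux lam" "B = ?cls g" "keys g \<subseteq> tableaux lam"
        unfolding carrierM by blast
      hence "h (A \<oplus>\<^bsub>column_module lam\<^esub> B) = 0" using AB h keys_plus by (simp add: addM linear_extension_add)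
      thus "A \<oplus>\<^bsub>column_module lam\<^esub> B \<in> {A \<in> carrier (column_module lam). h A = 0}" using AB by simp
    next
      fix A assume A: "A \<in> {A \<in> carrier (column_module lam). h A = 0}"
      have "\<ominus>\<^bsub>column_module lam\<^esub> A = (\<ominus>\<^bsub>complex_ring\<^esub> \<one>\<^bsub>complex_ring\<^esub>) \<odot>\<^bsub>column_module lam\<^esub> A"
        using A M.smult_l_minus[of "\<one>\<^bsub>complex_ring\<^esub>" A] M.smult_one[of A] by simp
      thus "\<ominus>\<^bsub>column_module lam\<^esub> A \<in> {A \<in> carrier (column_module lam). h A = 0}"
        using smult[OF A] by simp
    qed (use smult in auto)
  qed
  have h_kernel: "h A = 0 \<longleftrightarrow> A \<in> g_tilde_relations lam" if A: "A \<in> carrier (column_module lam)" for A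
  proof
    assume "A \<in> g_tilde_relations lam"
    thus "h A = 0" using h_zero by blast
  next
    assume "h A = 0"
    obtain f where f: "A = ?cls f" "keys f \<subseteq> tableaux lam" using A unfolding carrierM by blast
    \<comment> \<open>The preimage of \<open>g_tilde_relations\<close> in the free module. It
      contains the column relations, whose classes are zero, and the exchange relations, whose
      classes are the generators.\<close>
    let ?N = "{f. keys f \<subseteq> tableaux lam \<and> ?cls f \<in> g_tilde_relations lam}"
    have subM: "submodule (g_tilde_relations lam) complex_ring (column_module lam)" by (rule Q.sub.submodule_axioms)
    have zeroQ: "\<zero>\<^bsub>column_module lam\<^esub> \<in> g_tilde_relations lam" using Q.sub.one_closed by simp
    have "f \<in> ?N"
    proof (rule polytabloid_kernel_subset)
      show "submodule ?N complex_ring ?F"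
      proof (rule submodule_free_moduleI)
        show "0 \<in> ?N" using zeroQ by (simp add: zeroM)
      next
        fix f g assume "f \<in> ?N" "g \<in> ?N"
        thus "f + g \<in> ?N"
          using M.submoduleE(5)[OF subM, of "?cls f" "?cls g"] keys_add[of f g] by (auto simp: addM)
      next
        fix a :: complex and f assume "f \<in> ?N"
        thus "Poly_Mapping.map ((*) a) f \<in> ?N"
          using M.submoduleE(4)[OF subM, of a "?cls f"] keys_scale[of a f] by (auto simp: smultM)
      qed auto
    next
      fix f assume "f \<in> ?N"
      thus "?\<Phi> f = 0" using h h_zero by auto
    next
      fix t x y c assume *: "t \<in> tableaux lam" "x \<in> diagram_column lam c" "y \<in> diagram_column lam c" "x \<noteq> y"
      let ?f = "Poly_Mapping.single t (1 :: complex) + Poly_Mapping.single (switch x y t) 1"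
      have "?f \<in> column_relations lam"
        unfolding column_relations_def generated_submodule_def using * by (intro hull_inc) blast
      hence "?cls ?f = \<zero>\<^bsub>column_module lam\<^esub>" "keys ?f \<subseteq> tableaux lam"
        using F.a_rcos_const F.quotient_sels(2) column_relations_kernel unfolding column_module_def by auto
      thus "?f \<in> ?N" using zeroQ by simp
    next
      fix t c assume *: "t \<in> tableaux lam" "2 \<le> c" "c \<le> num_columns lam"
      hence "g_tilde lam c t \<in> g_tilde_relations lam"
        unfolding g_tilde_relations_def generated_submodule_def by (intro hull_inc) blast
      thus "exchange_relation lam c t \<in> ?N"
        using * keys_exchange_relation by (simp add: g_tilde_eq_coset)
    qed (use f \<open>h A = 0\<close> h in auto)
    thus "A \<in> g_tilde_relations lam" using f by simp
  qed
  show ?thesis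
    unfolding n S_tilde_def S_tilde_act_def
  proof (rule Q.first_isomorphism[OF specht_representation, where h = h])
    show "h \<in> carrier (column_module lam) \<rightarrow> carrier (specht_module lam)"
      by (auto simp: carrierM h specht_carrier)
    show "carrier (specht_module lam) \<subseteq> h ` carrier (column_module lam)"
      unfolding carrierM specht_carrier image_image by (auto simp: h intro!: image_eqI)
    show "h v = \<zero>\<^bsub>specht_module lam\<^esub> \<longleftrightarrow> v \<in> g_tilde_relations lam" if "v \<in> carrier (column_module lam)" for v
      using h_kernel[OF that] by simp
  next
    fix A B assume "A \<in> carrier (column_module lam)" "B \<in> carrier (column_module lam)"
    then obtain f g where "A = ?cls f" "keys f \<subseteq> tableaux lam" "B = ?cls g" "keys g \<subseteq> tableaux lam"
      unfolding carrierM by blast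
    thus "h (A \<oplus>\<^bsub>column_module lam\<^esub> B) = h A \<oplus>\<^bsub>specht_module lam\<^esub> h B"
      using h keys_plus by (simp add: addM linear_extension_add)
  next
    fix a A assume "A \<in> carrier (column_module lam)"
    then obtain f where "A = ?cls f" "keys f \<subseteq> tableaux lam" unfolding carrierM by blast
    thus "h (a \<odot>\<^bsub>column_module lam\<^esub> A) = a \<odot>\<^bsub>specht_module lam\<^esub> h A"
      using h keys_smult by (simp add: smultM linear_extension_scale)
  next
    fix g A assume "g \<in> carrier ?G" "A \<in> carrier (column_module lam)"
    then obtain f where g: "g permutes {1..sum_list lam}" and f: "A = ?cls f" "keys f \<subseteq> tableaux lam"
      unfolding carrierM sym_group_carrier by blast
    have "keys (free_act (tableaux lam) tableau_act g f) \<subseteq> tableaux lam"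
      using F.act_closed[of g f] g f by (simp add: sym_group_carrier)
    thus "h (column_module_act lam g A) = specht_act lam g (h A)"
      unfolding f(1) actM[OF g f(2)] h[OF f(2)] using h linear_extension_free_act[OF g f(2)] by simp
  qed
qed

end
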